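(* For every $d\in\mathbb{N}$ and $\ell\in\mathbb{N}$ there is a constant $C$, depending only on $d$ and $\ell$, such that for every $d$-simplex $K\subset\mathbb{R}^d$ and every $v\in H^1(K)$ \[ e(v,K)\le C\,\underline{e}(v,K), \qquad\text{where}\quad \underline{e}(v,K):=\Big(\sum_{i=1}^d\inf_{R\in\mathcal{P}_{\ell-1}(K)}\|\partial_iv-R\|_{L^2(K)}^2\Big)^{1/2} =\inf_{Q\in\mathcal{P}_{\ell-1}(K)^d}\|\nabla v-Q\|_{L^2(K)}. \]
   Context: $\mathcal{P}_m(K)$ denotes polynomials of total degree $\le m$ on $K$, and $e(v,K):=\inf_{P\in\mathcal{P}_\ell(K)}\|\nabla(v-P)\|_{L^2(K)}$, where $\|f\|_{L^2(K)}=(\int_K|f|^2)^{1/2}$ with $|\cdot|$ the Euclidean norm for vector fields. *)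

theory Defs
  imports "HOL-Analysis.Analysis"
begin

fun Ck :: "nat \<Rightarrow> (real^'n \<Rightarrow> real) \<Rightarrow> bool" where
  "Ck 0 f = continuous_on UNIV f"
| "Ck (Suc k) f = (continuous_on UNIV f \<and>
     (\<exists>D. (\<forall>x. (f has_derivative (\<lambda>h. D x \<bullet> h)) (at x)) \<and> (\<forall>i. Ck k (\<lambda>x. D x $ i))))"

definition smooth_fun :: "(real^'n \<Rightarrow> real) \<Rightarrow> bool" where
  "smooth_fun f \<longleftrightarrow> (\<forall>k. Ck k f)"

definition test_fun :: "(real^'n) set \<Rightarrow> (real^'n \<Rightarrow> real) \<Rightarrow> bool" where
  "test_fun K \<phi> \<longleftrightarrow> smooth_fun \<phi> \<and> compact (closure {x. \<phi> x \<noteq> 0}) \<and> closure {x. \<phi> x \<noteq> 0} \<subseteq> interior K"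

definition L2_on :: "(real^'n) set \<Rightarrow> (real^'n \<Rightarrow> real) \<Rightarrow> bool" where
  "L2_on K f \<longleftrightarrow> f \<in> borel_measurable (lebesgue_on K) \<and>
     set_integrable lebesgue K (\<lambda>x. (f x)\<^sup>2)"

definition L2_norm_on :: "(real^'n) set \<Rightarrow> (real^'n \<Rightarrow> real) \<Rightarrow> real" where
  "L2_norm_on K f = sqrt (LINT x:K|lebesgue. (f x)\<^sup>2)"

definition L2_vnorm_on :: "(real^'n) set \<Rightarrow> (real^'n \<Rightarrow> real^'n) \<Rightarrow> real" where
  "L2_vnorm_on K F = sqrt (LINT x:K|lebesgue. (norm (F x))\<^sup>2)"

definition weak_gradient :: "(real^'n) set \<Rightarrow> (real^'n \<Rightarrow> real) \<Rightarrow> (real^'n \<Rightarrow> real^'n) \<Rightarrow> bool" where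
  "weak_gradient K v g \<longleftrightarrow> (\<forall>i. L2_on K (\<lambda>x. g x $ i)) \<and>
     (\<forall>\<phi> D. test_fun K \<phi> \<longrightarrow> (\<forall>x. (\<phi> has_derivative (\<lambda>h. D x \<bullet> h)) (at x)) \<longrightarrow>
        (\<forall>i. (LINT x:K|lebesgue. v x * D x $ i) = - (LINT x:K|lebesgue. g x $ i * \<phi> x)))"

definition H1_with_grad :: "(real^'n) set \<Rightarrow> (real^'n \<Rightarrow> real) \<Rightarrow> (real^'n \<Rightarrow> real^'n) \<Rightarrow> bool" where
  "H1_with_grad K v g \<longleftrightarrow> L2_on K v \<and> weak_gradient K v g"

text \<open>Polynomials of total degree at most m (m an integer; for m < 0 only the zero polynomial,
  the convention P_{-1} = {0}).\<close>
definition polys :: "int \<Rightarrow> (real^'n \<Rightarrow> real) set" where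
  "polys m = {p. \<exists>c :: ('n \<Rightarrow> nat) \<Rightarrow> real.
      p = (\<lambda>x. \<Sum>\<alpha>\<in>{\<alpha>. int (\<Sum>i\<in>UNIV. \<alpha> i) \<le> m}. c \<alpha> * (\<Prod>i\<in>UNIV. (x $ i) ^ \<alpha> i))}"

text \<open>e(v,K) = inf over P in P_l of ||grad (v - P)||, with grad v = g.\<close>
definition err :: "nat \<Rightarrow> (real^'n) set \<Rightarrow> (real^'n \<Rightarrow> real^'n) \<Rightarrow> real" where
  "err l K g = Inf {L2_vnorm_on K (\<lambda>x. g x - G x) | P G. P \<in> polys (int l) \<and>
      (\<forall>x. (P has_derivative (\<lambda>h. G x \<bullet> h)) (at x))}"

definition err_low :: "nat \<Rightarrow> (real^'n) set \<Rightarrow> (real^'n \<Rightarrow> real^'n) \<Rightarrow> real" where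
  "err_low l K g = sqrt (\<Sum>i\<in>UNIV. (Inf {L2_norm_on K (\<lambda>x. g x $ i - R x) | R. R \<in> polys (int l - 1)})\<^sup>2)"

end

theory Submission
  imports Defs "HOL-Computational_Algebra.Polynomial"
begin

text \<open>
  Pull the simplex \<open>K\<close> back to a reference simplex by an affine map \<open>y \<mapsto> L y - b\<close> and let
  \<open>\<Pi>\<^sub>m v\<close> be the Taylor polynomial of degree \<open>m\<close> at the centre of the mollification of \<open>v\<close> by a test
  function \<open>\<eta>\<close> whose moments of orders \<open>1, \<dots>, l\<close> vanish. Since mollification and Taylor expansion
  commute with differentiation, \<open>\<partial>\<^sub>i \<Pi>\<^sub>l v = \<Pi>\<^sub>l\<^sub>-\<^sub>1 \<partial>\<^sub>i v\<close>: a single \<open>P = \<Pi>\<^sub>l v\<close> approximates all partial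
  derivatives at once. By the moment conditions \<open>\<Pi>\<^sub>l\<^sub>-\<^sub>1\<close> reproduces polynomials of degree \<open>l - 1\<close>, and its norm
  on \<open>L\<^sup>2(K)\<close> is affinely invariant, hence bounded independently of the shape of \<open>K\<close>; so each
  \<open>\<partial>\<^sub>i v - \<Pi>\<^sub>l\<^sub>-\<^sub>1 \<partial>\<^sub>i v\<close> is quasi-optimal.
\<close>

subsection \<open>A smooth bump with vanishing moments\<close>

text \<open>Best approximations of the separate partial derivatives need not form a gradient, and an
  estimate proved on a reference simplex and carried over to \<open>K\<close> would lose the
  condition number of the affine map. Both difficulties disappear because the operator is built in
  reference coordinates but applied to the Cartesian derivatives themselves. Differentiating in
  \<open>x\<close> brings out the transpose of \<open>L\<close> on the Taylor monomials and, through
  the weak gradient, the same transpose on the test function, so the two sides match exactly and no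
  norm of \<open>L\<close> or of its inverse is ever estimated. The only trace of the shape of
  \<open>K\<close> is the Jacobian factor \<open>J\<close>: the operator is bounded from L1 to the
  sup norm by a multiple of \<open>J\<close>, while the volume of \<open>K\<close> is bounded by a
  multiple of \<open>1 / J\<close>. Plain mollification alters polynomials of degree two or more,
  which is why moments must vanish. Taking the kernel as a tensor product reduces these conditions
  to the line. Its support is a cube about the barycentre whose size in barycentric coordinates
  depends on the dimension alone, so one kernel serves all simplices.\<close>

definition bump :: "real poly \<Rightarrow> nat \<Rightarrow> real \<Rightarrow> real" where
  "bump p N t = (if \<bar>t\<bar> < 1 then poly p t / (1 - t\<^sup>2) ^ N * exp (- 1 / (1 - t\<^sup>2)) else 0)"

text \<open>Second-order vanishing at the endpoints \<open>-1\<close> and \<open>1\<close> is what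
  makes the bump differentiable there, with derivative zero.\<close>

lemma bump_quadratic_bound:
  obtains C where "C \<ge> 0" "\<And>s. \<bar>bump p N s\<bar> \<le> C * (1 - s\<^sup>2)\<^sup>2"
proof -
  have "compact (poly p ` {-1..1})"
    by (intro compact_continuous_image continuous_intros) auto
  then have "bounded (poly p ` {-1..1})"
    by (rule compact_imp_bounded)
  then obtain B where B: "\<And>s. s \<in> {-1..1} \<Longrightarrow> \<bar>poly p s\<bar> \<le> B"
    unfolding bounded_iff by (metis imageI real_norm_def)
  have B0: "B \<ge> 0" using B[of 0] by auto
  have "\<bar>bump p N s\<bar> \<le> (B * fact (N + 2)) * (1 - s\<^sup>2)\<^sup>2" for s
  proof (cases "\<bar>s\<bar> < 1")
    case True
    define u where "u = 1 - s\<^sup>2"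
    have u: "u > 0" using True by (simp add: u_def abs_square_less_1)
    \<comment> \<open>A single term of the exponential series. The exponent \<open>N + 2\<close>
      leaves \<open>u^2\<close> over after the division by \<open>u ^ N\<close>.\<close>
    have "(1 / u) ^ (N + 2) / fact (N + 2) \<le> exp (1 / u)"
      using sum_le_suminf[OF summable_exp_generic[of "1 / u"], of "{N + 2}"] u
      by (simp add: exp_def scaleR_conv_of_real divide_inverse mult.commute del: fact_Suc)
    then have "u ^ (N + 2) * inverse (fact (N + 2)) * (1 / u) ^ (N + 2) \<le> u ^ (N + 2) * exp (1 / u)"
      using u by (simp add: divide_inverse mult_ac mult_left_mono del: fact_Suc add_2_eq_Suc' power_Suc)
    then have "1 \<le> fact (N + 2) * (u ^ (N + 2) * exp (1 / u))"
      using u by (simp add: power_one_over field_simps del: fact_Suc add_2_eq_Suc' power_Suc)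
    then have "exp (- 1 / u) \<le> fact (N + 2) * u ^ (N + 2)"
      using u by (simp add: exp_minus field_simps del: fact_Suc add_2_eq_Suc' power_Suc)
    then have "exp (- 1 / u) / u ^ N \<le> fact (N + 2) * u\<^sup>2"
      using u by (simp add: divide_le_eq power_add mult_ac del: fact_Suc add_2_eq_Suc' power_Suc)
    then have "\<bar>poly p s\<bar> * (exp (- 1 / u) / u ^ N) \<le> B * (fact (N + 2) * u\<^sup>2)"
      using B[of s] abs_less_iff[of s 1] True u B0 by (intro mult_mono) (auto simp del: fact_Suc add_2_eq_Suc')
    then show ?thesis
      using True u by (simp add: bump_def u_def[symmetric] abs_mult mult_ac)
  next
    case False
    then show ?thesis by (simp add: bump_def B0)
  qed
  then show thesis using that[of "B * fact (N + 2)"] B0 by auto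
qed

text \<open>The pair of parameters \<open>p\<close>, \<open>N\<close> makes the family closed under
  differentiation. With u = 1 - t^2, the derivative of p u^(-N) exp(-1/u) has the terms p' u^(-N), 2
  N t p u^(-N-1) and -2 t p u^(-N-2); over the common denominator u^(N+2) they give the polynomial
  in the statement.\<close>

lemma bump_deriv:
  "(bump p N has_real_derivative
     bump (pderiv p * [:1, 0, -1:]\<^sup>2 + [:0, 2 * real N:] * p * [:1, 0, -1:] - [:0, 2:] * p) (N + 2) t) (at t)"
  (is "(_ has_real_derivative bump ?q _ t) _")
proof -
  consider "\<bar>t\<bar> < 1" | "\<bar>t\<bar> > 1" | "\<bar>t\<bar> = 1" by linarith
  then show ?thesis
  proof cases
    case 1
    define u where "u = 1 - t\<^sup>2"
    have u: "u > 0" using 1 by (simp add: u_def abs_square_less_1)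
    have chain: "((\<lambda>s. poly p s / U s ^ N * exp (- 1 / U s)) has_real_derivative
        (poly (pderiv p) t * u ^ N - poly p t * (real N * u ^ (N - 1) * U')) / (u ^ N * u ^ N) * exp (- 1 / u)
         + poly p t / u ^ N * (exp (- 1 / u) * (U' / (u * u)))) (at t)"
      if "(U has_real_derivative U') (at t)" "U t = u" for U U'
      using u by (auto intro!: derivative_eq_intros that simp: that(2)) (simp add: field_simps)
    have "((\<lambda>s. 1 - s\<^sup>2) has_real_derivative - (2 * t)) (at t)"
      by (auto intro!: derivative_eq_intros)
    from chain[OF this] have "((\<lambda>s. poly p s / (1 - s\<^sup>2) ^ N * exp (- 1 / (1 - s\<^sup>2))) has_real_derivative
        (poly (pderiv p) t * u ^ N + poly p t * (real N * u ^ (N - 1) * (2 * t))) / (u ^ N * u ^ N) * exp (- 1 / u)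
         + poly p t / u ^ N * (exp (- 1 / u) * (- (2 * t) / (u * u)))) (at t)"
      by (simp add: u_def)
    moreover have "(poly (pderiv p) t * u ^ N + poly p t * (real N * u ^ (N - 1) * (2 * t))) / (u ^ N * u ^ N) * exp (- 1 / u)
         + poly p t / u ^ N * (exp (- 1 / u) * (- (2 * t) / (u * u))) = bump ?q (N + 2) t"
    proof -
      have q: "poly ?q t = poly (pderiv p) t * u\<^sup>2 + 2 * real N * t * poly p t * u - 2 * t * poly p t"
        by (simp add: u_def power2_eq_square algebra_simps)
      have "real N * u ^ (N - 1) * u = real N * u ^ N"
        by (cases N) auto
      then have frac: "(poly (pderiv p) t * u ^ N + poly p t * (real N * u ^ (N - 1) * (2 * t))) / (u ^ N * u ^ N)
        = poly (pderiv p) t / u ^ N + poly p t * real N * 2 * t / (u ^ N * u)"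
        using u by (auto simp: field_simps)
      have "bump ?q (N + 2) t = (poly (pderiv p) t * u\<^sup>2 + 2 * real N * t * poly p t * u - 2 * t * poly p t)
          / (u ^ N * (u * u)) * exp (- 1 / u)"
        using 1 unfolding bump_def q u_def[symmetric] by (simp add: power_add power2_eq_square mult_ac)
      moreover have "\<dots> = (poly (pderiv p) t / u ^ N + poly p t * real N * 2 * t / (u ^ N * u)) * exp (- 1 / u)
          + poly p t / u ^ N * (exp (- 1 / u) * (- (2 * t) / (u * u)))"
        using u by (simp add: field_simps power2_eq_square)
      ultimately show ?thesis unfolding frac by simp
    qed
    ultimately have "((\<lambda>s. poly p s / (1 - s\<^sup>2) ^ N * exp (- 1 / (1 - s\<^sup>2))) has_real_derivative bump ?q (N + 2) t) (at t)"
      by simp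
    then show ?thesis
    proof (rule DERIV_cong_ev[OF refl _ refl, THEN iffD1, rotated])
      have "\<forall>\<^sub>F s in nhds t. s \<in> {-1<..<1}"
        using 1 by (intro eventually_nhds_in_open) auto
      then show "\<forall>\<^sub>F s in nhds t. poly p s / (1 - s\<^sup>2) ^ N * exp (- 1 / (1 - s\<^sup>2)) = bump p N s"
        by eventually_elim (auto simp: bump_def)
    qed
  next
    case 2
    have "((\<lambda>s. 0) has_real_derivative bump ?q (N + 2) t) (at t)"
      using 2 by (simp add: bump_def)
    then show ?thesis
    proof (rule DERIV_cong_ev[OF refl _ refl, THEN iffD1, rotated])
      have "\<forall>\<^sub>F s in nhds t. s \<in> - {-1..1}"
        using 2 by (intro eventually_nhds_in_open) auto
      then show "\<forall>\<^sub>F s in nhds t. 0 = bump p N s"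
        by eventually_elim (auto simp: bump_def)
    qed
  next
    case 3
    obtain C where C: "C \<ge> 0" "\<And>s. \<bar>bump p N s\<bar> \<le> C * (1 - s\<^sup>2)\<^sup>2"
      using bump_quadratic_bound by blast
    have t2: "t\<^sup>2 = 1" using 3 by (simp add: abs_square_eq_1)
    \<comment> \<open>Since t^2 = 1, the factor 1 - (t + h)^2 equals -h (2 t + h). The quadratic
      bound therefore makes the difference quotient O(h).\<close>
    have "((\<lambda>h. (bump p N (t + h) - bump p N t) / h) \<longlongrightarrow> 0) (at 0)"
    proof (rule Lim_null_comparison)
      have "\<bar>(bump p N (t + h) - bump p N t) / h\<bar> \<le> C * (2 * t + h)\<^sup>2 * \<bar>h\<bar>" for h
      proof (cases "h = 0")
        case False
        have "1 - (t + h)\<^sup>2 = - h * (2 * t + h)"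
          using t2 by (simp add: power2_eq_square algebra_simps)
        then have "\<bar>bump p N (t + h)\<bar> \<le> C * (h * (2 * t + h))\<^sup>2"
          using C(2)[of "t + h"] by simp
        then show ?thesis using False 3
          by (simp add: bump_def[of p N t] abs_divide divide_le_eq power_mult_distrib mult_ac power2_eq_square
              abs_mult_self_eq)
      qed simp
      then show "\<forall>\<^sub>F h in at 0. norm ((bump p N (t + h) - bump p N t) / h) \<le> C * (2 * t + h)\<^sup>2 * \<bar>h\<bar>"
        by simp
      have "((\<lambda>h. C * (2 * t + h)\<^sup>2 * \<bar>h\<bar>) \<longlongrightarrow> C * (2 * t + 0)\<^sup>2 * \<bar>0\<bar>) (at 0)"
        by (intro tendsto_intros)
      then show "((\<lambda>h. C * (2 * t + h)\<^sup>2 * \<bar>h\<bar>) \<longlongrightarrow> 0) (at 0)" by simp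
    qed
    moreover have "bump ?q (N + 2) t = 0" using 3 by (simp only: bump_def) simp
    ultimately show ?thesis unfolding DERIV_def by (simp only:)
  qed
qed

section \<open>Compactly supported functions on the line, their derivatives and moments\<close>

text \<open>A smooth function is carried together with all its derivatives, \<open>\<eta> a\<close>
  being the a-th one. Tensor products can then be indexed directly by multi-indices, without any
  derivative operator.\<close>

definition smooth_tower :: "real \<Rightarrow> (nat \<Rightarrow> real \<Rightarrow> real) \<Rightarrow> bool" where
  "smooth_tower r \<eta> \<longleftrightarrow> (\<forall>a t. (\<eta> a has_real_derivative \<eta> (Suc a) t) (at t)) \<and>
     (\<forall>a t. r \<le> \<bar>t\<bar> \<longrightarrow> \<eta> a t = 0)"

lemma smooth_tower_bump:
  obtains \<eta> where "smooth_tower 1 \<eta>" "\<And>t. \<eta> 0 t = bump 1 0 t"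
proof -
  \<comment> \<open>The recursion is the one of \<open>bump_deriv\<close>; each derivative raises
    the exponent of the denominator by two, hence \<open>2 * j\<close>.\<close>
  define P where "P = rec_nat (1 :: real poly) (\<lambda>j p. pderiv p * [:1, 0, -1:]\<^sup>2
     + [:0, 2 * real (2 * j):] * p * [:1, 0, -1:] - [:0, 2:] * p)"
  define \<eta> where "\<eta> j = bump (P j) (2 * j)" for j
  have "(\<eta> a has_real_derivative \<eta> (Suc a) t) (at t)" for a t
    using bump_deriv[of "P a" "2 * a" t] by (simp add: \<eta>_def P_def)
  moreover have "\<eta> a t = 0" if "1 \<le> \<bar>t\<bar>" for a t
    using that by (simp add: \<eta>_def bump_def)
  moreover have "\<eta> 0 t = bump 1 0 t" for t by (simp add: \<eta>_def P_def)
  ultimately show thesis using that[of \<eta>] by (auto simp: smooth_tower_def)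
qed

lemma smooth_tower_continuous: "smooth_tower r \<eta> \<Longrightarrow> continuous_on UNIV (\<eta> a)"
  by (auto simp: smooth_tower_def continuous_on_eq_continuous_at intro!: DERIV_isCont)

lemma smooth_tower_isCont: "smooth_tower r \<eta> \<Longrightarrow> isCont (\<eta> a) t"
  by (auto simp: smooth_tower_def intro!: DERIV_isCont)

lemma integrable_continuous_compact_support:
  fixes f :: "'a::euclidean_space \<Rightarrow> real"
  assumes "continuous_on UNIV f" "compact S" "\<And>x. x \<notin> S \<Longrightarrow> f x = 0"
  shows "integrable lborel f"
proof -
  have "integrable lborel (\<lambda>x. indicator S x *\<^sub>R f x)"
    using assms by (intro borel_integrable_compact continuous_on_subset[OF assms(1)]) auto
  moreover have "(\<lambda>x. indicator S x *\<^sub>R f x) = f"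
    using assms(3) by (auto simp: indicator_def fun_eq_iff)
  ultimately show ?thesis by simp
qed

lemma integrable_smooth_tower_moment:
  assumes "smooth_tower r \<eta>"
  shows "integrable lborel (\<lambda>t. \<eta> a t * t ^ b)"
proof (rule integrable_continuous_compact_support)
  show "continuous_on UNIV (\<lambda>t. \<eta> a t * t ^ b)"
    by (intro continuous_intros smooth_tower_continuous[OF assms])
  show "compact {-\<bar>r\<bar>..\<bar>r\<bar>}" by simp
  show "\<And>t. t \<notin> {-\<bar>r\<bar>..\<bar>r\<bar>} \<Longrightarrow> \<eta> a t * t ^ b = 0"
    using assms by (auto simp: smooth_tower_def not_le)
qed

text \<open>Integration by parts, with boundary terms that vanish because the tower is zero at
  \<open>r\<close> and \<open>-r\<close>. For \<open>b = 0\<close> the factor \<open>real b\<close>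
  makes the truncated exponent \<open>b - 1\<close> harmless.\<close>

lemma smooth_tower_moment_Suc:
  assumes "smooth_tower r \<eta>" "r > 0"
  shows "(LINT t|lborel. \<eta> (Suc a) t * t ^ b) = - real b * (LINT t|lborel. \<eta> a t * t ^ (b - 1))"
proof -
  have 0: "\<eta> a t = 0" if "\<not> (- r < t \<and> t < r)" for a t using assms that by (auto simp: smooth_tower_def)
  have "(LINT t|lborel. (t ^ b * \<eta> (Suc a) t) * indicator {-r..r} t) =
     r ^ b * \<eta> a r - (-r) ^ b * \<eta> a (-r) - (LINT t|lborel. (real b * t ^ (b - 1) * \<eta> a t) * indicator {-r..r} t)"
    using assms by (intro integral_by_parts)
      (auto intro!: derivative_eq_intros continuous_intros smooth_tower_isCont[OF assms(1)] simp: smooth_tower_def)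
  moreover have "(LINT t|lborel. (t ^ b * \<eta> (Suc a) t) * indicator {-r..r} t) = (LINT t|lborel. \<eta> (Suc a) t * t ^ b)"
    by (intro Bochner_Integration.integral_cong refl) (auto simp: indicator_def intro!: 0)
  moreover have "(LINT t|lborel. (real b * t ^ (b - 1) * \<eta> a t) * indicator {-r..r} t)
      = (LINT t|lborel. real b * (\<eta> a t * t ^ (b - 1)))"
    by (intro Bochner_Integration.integral_cong refl) (auto simp: indicator_def intro!: 0)
  ultimately show ?thesis using assms(2) by (simp add: 0)
qed

text \<open>Repeated integration by parts lowers \<open>b\<close> together with \<open>a\<close>, so
  a moment bound on \<open>\<eta> 0\<close> alone controls every derivative, with no restriction on
  \<open>a\<close>. The result is a duality between derivatives of the kernel and powers, the
  one-dimensional source of polynomial reproduction.\<close>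

lemma smooth_tower_moment:
  assumes "smooth_tower r \<eta>" "r > 0"
    and m: "\<And>b. b \<le> m \<Longrightarrow> (LINT t|lborel. \<eta> 0 t * t ^ b) = (if b = 0 then 1 else 0)"
  shows "b \<le> m \<Longrightarrow> (-1) ^ a * (LINT t|lborel. \<eta> a t * t ^ b) = (if a = b then fact a else 0)"
proof (induction a arbitrary: b)
  case 0
  then show ?case using m by auto
next
  case (Suc a)
  show ?case
  proof (cases b)
    case 0
    then show ?thesis using smooth_tower_moment_Suc[OF assms(1,2), of a 0] by simp
  next
    case (Suc b')
    have "(-1) ^ Suc a * (LINT t|lborel. \<eta> (Suc a) t * t ^ b) = real b * ((-1) ^ a * (LINT t|lborel. \<eta> a t * t ^ b'))"
      by (simp only: smooth_tower_moment_Suc[OF assms(1,2), of a b]) (simp add: Suc algebra_simps)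
    then show ?thesis using Suc.IH[of b'] Suc.prems Suc by simp
  qed
qed

lemma smooth_tower_dilate:
  assumes "smooth_tower r \<eta>" "c > 0"
  shows "smooth_tower (r / c) (\<lambda>a t. c ^ a * \<eta> a (c * t))"
  unfolding smooth_tower_def
proof (intro conjI allI impI)
  fix a t
  have "((\<lambda>t. \<eta> a (c * t)) has_real_derivative \<eta> (Suc a) (c * t) * c) (at t)"
    using assms(1) by (intro DERIV_chain2[where f = "\<eta> a" and g = "\<lambda>t. c * t"])
      (auto simp: smooth_tower_def intro!: derivative_eq_intros)
  then show "((\<lambda>t. c ^ a * \<eta> a (c * t)) has_real_derivative c ^ Suc a * \<eta> (Suc a) (c * t)) (at t)"
    by (auto intro!: derivative_eq_intros)
  assume "r / c \<le> \<bar>t\<bar>"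
  then have "r \<le> \<bar>c * t\<bar>" using assms(2) by (simp add: abs_mult field_simps)
  then show "c ^ a * \<eta> a (c * t) = 0" using assms(1) by (simp add: smooth_tower_def)
qed

lemma smooth_tower_mono: "smooth_tower r \<eta> \<Longrightarrow> r \<le> s \<Longrightarrow> smooth_tower s \<eta>"
  by (auto simp: smooth_tower_def)

lemma smooth_tower_lincomb:
  assumes "smooth_tower r \<eta>" "smooth_tower r \<theta>"
  shows "smooth_tower r (\<lambda>a t. A * \<eta> a t + B * \<theta> a t)"
  using assms unfolding smooth_tower_def by (auto intro!: derivative_eq_intros)

lemma moment_dilate:
  fixes f :: "real \<Rightarrow> real"
  assumes "c > 0"
  shows "(LINT t|lborel. f (c * t) * t ^ b) = (LINT t|lborel. f t * t ^ b) / c ^ Suc b"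
proof -
  have "(LINT t|lborel. f t * t ^ b) = c * (LINT t|lborel. f (c * t) * (c * t) ^ b)"
    using lborel_integral_real_affine[of c "\<lambda>t. f t * t ^ b" 0] assms by simp
  also have "\<dots> = c ^ Suc b * (LINT t|lborel. f (c * t) * t ^ b)"
    by (simp add: power_mult_distrib mult.left_commute)
  finally show ?thesis using assms by simp
qed

text \<open>Richardson extrapolation: a kernel and its dilation by 2 have b-th moments in the ratio
  2^(b+1), so a linear combination kills the next moment and keeps the normalization. Dilation by 2
  shrinks the support, so \<open>r\<close> stays fixed throughout the induction.\<close>

lemma smooth_tower_vanishing_moments:
  assumes "r > 0"
  shows "\<exists>\<eta>. smooth_tower r \<eta> \<and>
    (\<forall>b\<le>m. (LINT t|lborel. \<eta> 0 t * t ^ b) = (if b = 0 then 1 else 0))"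
proof (induction m)
  case 0
  obtain \<theta> where \<theta>: "smooth_tower 1 \<theta>" "\<And>t. \<theta> 0 t = bump 1 0 t"
    using smooth_tower_bump by blast
  define I where "I = (LINT t|lborel. \<theta> 0 t)"
  have int: "integrable lborel (\<theta> 0)"
    using integrable_smooth_tower_moment[OF \<theta>(1), of 0 0] by simp
  \<comment> \<open>Positivity of the integral, needed to normalize: on [-1/2, 1/2] the bump is at
    least exp(-4/3), hence at least exp(-2).\<close>
  have "(LINT t|lborel. indicator {-1/2..1/2::real} t * exp (-2)) \<le> I"
    unfolding I_def
  proof (rule integral_mono[OF _ int])
    show "integrable lborel (\<lambda>t::real. indicator {-1/2..1/2} t * exp (-2) :: real)" by simp
    fix t :: real
    show "indicator {-1/2..1/2} t * exp (-2) \<le> \<theta> 0 t"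
    proof (cases "t \<in> {-1/2..1/2}")
      case True
      then have "\<bar>t\<bar> \<le> 1/2" by auto
      then have "t\<^sup>2 \<le> (1/2)\<^sup>2" by (rule power2_le_iff_abs_le[THEN iffD2, rotated]) simp
      then show ?thesis using True by (auto simp: \<theta>(2) bump_def power2_eq_square field_simps)
    next
      case False
      then show ?thesis by (simp add: \<theta>(2) bump_def)
    qed
  qed
  moreover have "(LINT t|lborel. indicator {-1/2..1/2::real} t * exp (-2::real)) = exp (-2)"
    by simp
  ultimately have I: "I > 0" using exp_gt_zero[of "-2::real"] by linarith
  \<comment> \<open>The factor \<open>1 / (r * I)\<close> normalizes the integral after stretching
    the support to radius \<open>r\<close>. The zero summand brings the function into the form of
    \<open>smooth_tower_lincomb\<close>.\<close>
  define \<eta> where "\<eta> a t = (1 / (r * I)) * ((1 / r) ^ a * \<theta> a (1 / r * t)) + 0 * ((1 / r) ^ a * \<theta> a (1 / r * t))"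
    for a t
  have "smooth_tower r \<eta>"
    unfolding \<eta>_def
    using smooth_tower_dilate[OF \<theta>(1), of "1 / r"] assms by (intro smooth_tower_lincomb) auto
  moreover have "(LINT t|lborel. \<eta> 0 t * t ^ 0) = 1"
    using I assms moment_dilate[of "1/r" "\<theta> 0" 0] by (simp add: \<eta>_def I_def[symmetric])
  ultimately show ?case by auto
next
  case (Suc m)
  then obtain \<theta> where \<theta>: "smooth_tower r \<theta>"
    and mom: "\<And>b. b \<le> m \<Longrightarrow> (LINT t|lborel. \<theta> 0 t * t ^ b) = (if b = 0 then 1 else 0)" by auto
  define q where "q = (2::real) ^ Suc m"
  have q: "q > 1" unfolding q_def by (rule one_less_power) auto
  have dil: "smooth_tower r (\<lambda>a t. 2 ^ a * \<theta> a (2 * t))"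
    using smooth_tower_mono[OF smooth_tower_dilate[OF \<theta>, of 2], of r] assms by simp
  \<comment> \<open>The coefficients multiply the b-th moment by (q / 2^b - 1) / (q - 1). This is 1
    for b = 0 and 0 for b = m + 1; in between, the moment is already zero. The extra 2 in
    \<open>2 * q\<close> compensates the substitution t -> 2 t.\<close>
  define \<eta> where "\<eta> a t = (2 * q / (q - 1)) * (2 ^ a * \<theta> a (2 * t)) + (- 1 / (q - 1)) * \<theta> a t" for a t
  have "smooth_tower r \<eta>" unfolding \<eta>_def by (intro smooth_tower_lincomb dil \<theta>)
  moreover have "(LINT t|lborel. \<eta> 0 t * t ^ b) = (if b = 0 then 1 else 0)" if "b \<le> Suc m" for b
  proof -
    have "(LINT t|lborel. \<eta> 0 t * t ^ b) = (LINT t|lborel. (2 * q / (q - 1)) * (\<theta> 0 (2 * t) * t ^ b)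
        + (- 1 / (q - 1)) * (\<theta> 0 t * t ^ b))"
      by (simp add: \<eta>_def algebra_simps)
    also have "\<dots> = (2 * q / (q - 1)) * (LINT t|lborel. \<theta> 0 (2 * t) * t ^ b)
        + (- 1 / (q - 1)) * (LINT t|lborel. \<theta> 0 t * t ^ b)"
      using integrable_smooth_tower_moment[OF dil, of 0 b] integrable_smooth_tower_moment[OF \<theta>, of 0 b]
      by (subst Bochner_Integration.integral_add) auto
    also have "\<dots> = (2 * q / (q - 1)) * ((LINT t|lborel. \<theta> 0 t * t ^ b) / 2 ^ Suc b)
        + (- 1 / (q - 1)) * (LINT t|lborel. \<theta> 0 t * t ^ b)"
      by (subst moment_dilate) simp_all
    also have "\<dots> = ((q / 2 ^ b - 1) / (q - 1)) * (LINT t|lborel. \<theta> 0 t * t ^ b)"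
    proof -
      have "2 * q / s * (I / (2 * D)) + (- 1 / s) * I = ((q / D - 1) / s) * I" if "s > 0" "D > 0" for s D I :: real
        using that by (simp add: field_simps)
      from this[of "q - 1" "2 ^ b"] show ?thesis using q by simp
    qed
    also have "\<dots> = (if b = 0 then 1 else 0)"
    proof (cases "b = Suc m")
      case True
      then show ?thesis by (simp add: q_def)
    next
      case False
      then show ?thesis using that mom[of b] q by auto
    qed
    finally show ?thesis .
  qed
  ultimately show ?case by (intro exI[of _ \<eta>]) blast
qed

subsection \<open>Affine changes of variables\<close>

lemma nn_integral_lborel_translate:
  fixes h :: "'a::euclidean_space \<Rightarrow> ennreal"
  assumes [measurable]: "h \<in> borel_measurable borel"
  shows "(\<integral>\<^sup>+x. h (t + x) \<partial>lborel) = (\<integral>\<^sup>+x. h x \<partial>lborel)"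
proof -
  have "(\<integral>\<^sup>+x. h x \<partial>lborel) = (\<integral>\<^sup>+x. h x \<partial>distr lborel borel ((+) t))"
    by (simp add: lborel_distr_plus)
  then show ?thesis by (simp add: nn_integral_distr)
qed

lemma nn_integral_lborel_reflect:
  fixes h :: "'a::euclidean_space \<Rightarrow> ennreal"
  assumes [measurable]: "h \<in> borel_measurable borel"
  shows "(\<integral>\<^sup>+x. h (t - x) \<partial>lborel) = (\<integral>\<^sup>+x. h x \<partial>lborel)"
proof -
  have "(\<integral>\<^sup>+x. h x \<partial>lborel) = (\<integral>\<^sup>+x. h x \<partial>density (distr lborel borel (\<lambda>x. t + (-1) *\<^sub>R x)) (\<lambda>_. ennreal (\<bar>-1\<bar> ^ DIM('a))))"
    by (subst lborel_affine[of "-1" t]) auto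
  then show ?thesis by (simp add: density_1 nn_integral_distr)
qed

text \<open>The uniqueness argument for Haar measure. It replaces the determinant formula, which the
  library only has for well-ordered index types.\<close>
lemma nn_integral_linear_exchange:
  fixes L :: "'a::euclidean_space \<Rightarrow> 'a" and f g :: "'a \<Rightarrow> ennreal"
  assumes L: "linear L" "surj L"
    and [measurable]: "f \<in> borel_measurable borel" "g \<in> borel_measurable borel"
  shows "(\<integral>\<^sup>+u. f (L u) \<partial>lborel) * (\<integral>\<^sup>+y. g y \<partial>lborel) = (\<integral>\<^sup>+u. g (L u) \<partial>lborel) * (\<integral>\<^sup>+y. f y \<partial>lborel)"
proof -
  have [measurable]: "L \<in> borel_measurable borel"
    by (intro borel_measurable_continuous_onI linear_continuous_on linear_conv_bounded_linear[THEN iffD1] L)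
  have shift: "(\<integral>\<^sup>+u. f1 (L u) \<partial>lborel) * (\<integral>\<^sup>+y. g1 y \<partial>lborel) = (\<integral>\<^sup>+y. \<integral>\<^sup>+u. f1 (L u) * g1 (y - L u) \<partial>lborel \<partial>lborel)"
    if [measurable]: "f1 \<in> borel_measurable borel" "g1 \<in> borel_measurable borel" for f1 g1 :: "'a \<Rightarrow> ennreal"
  proof -
    have "(\<integral>\<^sup>+u. f1 (L u) \<partial>lborel) * (\<integral>\<^sup>+y. g1 y \<partial>lborel) = (\<integral>\<^sup>+u. f1 (L u) * (\<integral>\<^sup>+y. g1 y \<partial>lborel) \<partial>lborel)"
      by (simp add: nn_integral_multc)
    also have "\<dots> = (\<integral>\<^sup>+u. f1 (L u) * (\<integral>\<^sup>+y. g1 (- L u + y) \<partial>lborel) \<partial>lborel)"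
      by (simp only: nn_integral_lborel_translate[OF that(2)])
    also have "\<dots> = (\<integral>\<^sup>+u. \<integral>\<^sup>+y. f1 (L u) * g1 (y - L u) \<partial>lborel \<partial>lborel)"
      by (simp add: nn_integral_cmult)
    also have "\<dots> = (\<integral>\<^sup>+y. \<integral>\<^sup>+u. f1 (L u) * g1 (y - L u) \<partial>lborel \<partial>lborel)"
      by (rule lborel_pair.Fubini') measurable
    finally show ?thesis .
  qed
  have "(\<integral>\<^sup>+u. f (L u) * g (y - L u) \<partial>lborel) = (\<integral>\<^sup>+u. g (L u) * f (y - L u) \<partial>lborel)" for y
  proof -
    \<comment> \<open>With y = L w, the substitution u -> w - u exchanges L u and y - L u, and so
      the roles of \<open>f\<close> and \<open>g\<close>.\<close>
    obtain w where w: "y = L w" using L(2) by (meson surjD)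
    have "(\<integral>\<^sup>+u. f (L (w - u)) * g (y - L (w - u)) \<partial>lborel) = (\<integral>\<^sup>+u. f (L u) * g (y - L u) \<partial>lborel)"
      by (rule nn_integral_lborel_reflect[where h = "\<lambda>u. f (L u) * g (y - L u)"]) measurable
    then show ?thesis by (simp add: w linear_diff[OF L(1)] mult.commute)
  qed
  then show ?thesis by (simp add: shift)
qed

text \<open>\<open>J\<close> stands for |det L|, obtained as the reciprocal of the volume of the
  preimage of the unit cube. That volume is finite because the preimage is a compact linear image of
  the cube, and nonzero because otherwise the whole space would be a null set.\<close>

lemma emeasure_affine_vimage:
  fixes L :: "'a::euclidean_space \<Rightarrow> 'a" and b :: 'a
  assumes L: "linear L" "surj L"
  obtains J where "J > 0"
    "\<And>A. A \<in> sets borel \<Longrightarrow> emeasure lborel ((\<lambda>y. L y - b) -` A) = ennreal (1 / J) * emeasure lborel A"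
proof -
  have [measurable]: "L \<in> borel_measurable borel"
    by (intro borel_measurable_continuous_onI linear_continuous_on linear_conv_bounded_linear[THEN iffD1] L)
  define Q :: "'a set" where "Q = cbox 0 One"
  have Q: "emeasure lborel Q = 1" by (simp add: Q_def emeasure_lborel_cbox_eq)
  obtain L' where L': "linear L'" "L \<circ> L' = id" "L' \<circ> L = id"
    using linear_surjective_isomorphism[OF L] by (metis comp_apply eq_id_iff)
  have "L -` Q = L' ` Q"
  proof
    show "L -` Q \<subseteq> L' ` Q" using L'(3) by (metis comp_apply id_apply image_iff subsetI vimage_eq)
    show "L' ` Q \<subseteq> L -` Q" using L'(2) by (metis comp_apply id_apply image_subset_iff vimage_eq)
  qed
  moreover have "compact (L' ` Q)"
    unfolding Q_def by (intro compact_continuous_image linear_continuous_on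
        linear_conv_bounded_linear[THEN iffD1] L') auto
  ultimately have fin: "emeasure lborel (L -` Q) < \<infinity>"
    by (metis emeasure_compact_finite)
  have vim: "emeasure lborel (L -` A) = emeasure lborel (L -` Q) * emeasure lborel A"
    if [measurable]: "A \<in> sets borel" for A
  proof -
    have [measurable]: "Q \<in> sets borel" by (simp add: Q_def)
    have *: "(\<integral>\<^sup>+u. indicator B (L u) \<partial>lborel) = emeasure lborel (L -` B)" if [measurable]: "B \<in> sets borel" for B
    proof -
      have "(\<integral>\<^sup>+u. indicator B (L u) \<partial>lborel) = (\<integral>\<^sup>+u. indicator (L -` B) u \<partial>lborel)"
        by (intro nn_integral_cong) (auto simp: indicator_def)
      also have "\<dots> = emeasure lborel (L -` B)"
        using measurable_sets[OF \<open>L \<in> borel_measurable borel\<close> that] by (intro nn_integral_indicator) simp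
      finally show ?thesis .
    qed
    show ?thesis
      using nn_integral_linear_exchange[OF L, of "indicator A" "indicator Q"] by (simp add: * Q)
  qed
  have pos: "emeasure lborel (L -` Q) \<noteq> 0"
  proof
    assume "emeasure lborel (L -` Q) = 0"
    then have "emeasure lborel (UNIV :: 'a set) = 0" using vim[of UNIV] by simp
    then show False by (simp add: emeasure_lborel_UNIV)
  qed
  define c where "c = measure lborel (L -` Q)"
  have c: "emeasure lborel (L -` Q) = ennreal c" using fin by (simp add: c_def emeasure_eq_ennreal_measure)
  have c0: "c > 0" using pos c by (metis c_def ennreal_0 measure_nonneg less_eq_real_def)
  have "emeasure lborel ((\<lambda>y. L y - b) -` A) = ennreal c * emeasure lborel A" if A [measurable]: "A \<in> sets borel" for A
  proof -
    have "(\<lambda>y. L y - b) -` A = L -` ((+) (- b) -` A)" by auto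
    moreover have "emeasure lborel ((+) (- b) -` A) = emeasure lborel A"
      using emeasure_distr[of "(+) (- b)" lborel borel A] by (simp add: lborel_distr_plus)
    moreover have "(+) (- b) -` A \<in> sets borel"
      using measurable_sets[of "(+) (- b)" borel borel A] by simp
    ultimately show ?thesis using vim c by simp
  qed
  then show thesis using that[of "1 / c"] c0 by simp
qed

lemma lborel_integral_affine:
  fixes L :: "'a::euclidean_space \<Rightarrow> 'a" and f :: "'a \<Rightarrow> real"
  assumes L: "linear L" and "J > 0"
    and J: "\<And>A. A \<in> sets borel \<Longrightarrow> emeasure lborel ((\<lambda>y. L y - b) -` A) = ennreal (1 / J) * emeasure lborel A"
    and [measurable]: "f \<in> borel_measurable borel"
  shows "J * (LINT y|lborel. f (L y - b)) = (LINT y|lborel. f y)"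
proof -
  have [measurable]: "L \<in> borel_measurable borel"
    by (intro borel_measurable_continuous_onI linear_continuous_on linear_conv_bounded_linear[THEN iffD1] L)
  have "distr lborel borel (\<lambda>y. L y - b) = density lborel (\<lambda>_. ennreal (1 / J))"
    by (rule measure_eqI) (simp_all add: emeasure_distr J emeasure_density nn_integral_cmult)
  then have "(LINT y|distr lborel borel (\<lambda>y. L y - b). f y) = (LINT y|density lborel (\<lambda>_. ennreal (1 / J)). f y)"
    by simp
  then have "(LINT y|lborel. f (L y - b)) = (1 / J) * (LINT y|lborel. f y)"
    using \<open>J > 0\<close> by (simp add: integral_distr integral_density)
  then show ?thesis using \<open>J > 0\<close> by simp
qed

text \<open>Fubini's theorem for tensor products. Lebesgue measure is a product over basis vectors,
  so the factors are relabelled from coordinates to unit vectors \<open>axis i 1\<close>.\<close>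

lemma lborel_integral_prod_cart:
  fixes f :: "'n::finite \<Rightarrow> real \<Rightarrow> real"
  assumes "\<And>i. integrable lborel (f i)"
  shows "(LINT x|lborel. (\<Prod>i\<in>UNIV. f i (x $ i))) = (\<Prod>i\<in>UNIV. (LINT t|lborel. f i t))"
proof -
  interpret product_sigma_finite "\<lambda>_::real^'n. lborel :: real measure" ..
  have [measurable]: "f i \<in> borel_measurable borel" for i
    using borel_measurable_integrable[OF assms[of i]] by simp
  define g where "g b = f (THE i. b = axis i 1)" for b :: "real^'n"
  have g: "g (axis i 1) = f i" for i
    unfolding g_def by (rule arg_cong[where f = f]) (auto simp: axis_eq_axis)
  have reindex: "(\<Prod>b\<in>Basis. h b) = (\<Prod>i\<in>UNIV. h (axis i 1))" for h :: "real^'n \<Rightarrow> real"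
  proof -
    have "Basis = (\<lambda>i. axis i 1 :: real^'n) ` (UNIV :: 'n set)" by (auto simp: Basis_vec_def Basis_real_def)
    then have "(\<Prod>b\<in>Basis. h b) = prod h ((\<lambda>i. axis i 1) ` (UNIV :: 'n set))"
      by (rule arg_cong)
    also have "\<dots> = (\<Prod>i\<in>UNIV. h (axis i 1))"
      by (subst prod.reindex) (auto simp: inj_on_def axis_eq_axis)
    finally show ?thesis .
  qed
  have [measurable]: "g b \<in> borel_measurable borel" for b by (simp add: g_def)
  have "(LINT x|lborel. (\<Prod>i\<in>UNIV. f i (x $ i))) = (LINT x|lborel. (\<Prod>b\<in>Basis. g b (x \<bullet> b)))"
    by (simp add: reindex g inner_axis)
  also have "\<dots> = (LINT x|(\<Pi>\<^sub>M b\<in>Basis. lborel). (\<Prod>b\<in>Basis. g b ((\<Sum>b\<in>Basis. x b *\<^sub>R b) \<bullet> b)))"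
    by (subst lborel_eq, subst integral_distr) auto
  also have "\<dots> = (LINT x|(\<Pi>\<^sub>M b\<in>Basis. lborel). (\<Prod>b\<in>Basis. g b (x b)))"
    by (intro Bochner_Integration.integral_cong refl prod.cong) simp
  also have "\<dots> = (\<Prod>b\<in>Basis. (LINT t|lborel. g b t))"
    using assms by (intro product_integral_prod) (auto simp: g_def)
  also have "\<dots> = (\<Prod>i\<in>UNIV. (LINT t|lborel. f i t))"
    by (simp add: reindex g)
  finally show ?thesis .
qed

subsection \<open>Tensor products and polynomials\<close>

lemma Ck_imp_continuous: "Ck k f \<Longrightarrow> continuous_on UNIV f"
  by (cases k) auto

text \<open>After an affine pull-back, each partial derivative of a tensor product is a combination
  of this kind, with entries of \<open>L\<close> as coefficients.\<close>

lemma Ck_sum: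
  fixes f :: "'j::finite \<Rightarrow> real^'n \<Rightarrow> real"
  shows "(\<And>j. Ck k (f j)) \<Longrightarrow> Ck k (\<lambda>x. \<Sum>j\<in>UNIV. c j * f j x)"
proof (induction k arbitrary: f)
  case 0
  then show ?case by (auto intro!: continuous_intros)
next
  case (Suc k)
  then have "\<forall>j. \<exists>D. (\<forall>x. (f j has_derivative (\<lambda>h. D x \<bullet> h)) (at x)) \<and> (\<forall>i. Ck k (\<lambda>x. D x $ i))"
    by simp
  then obtain D where D: "\<And>j x. (f j has_derivative (\<lambda>h. D j x \<bullet> h)) (at x)"
    "\<And>j i. Ck k (\<lambda>x. D j x $ i)" by metis
  have "((\<lambda>x. \<Sum>j\<in>UNIV. c j * f j x) has_derivative (\<lambda>h. (\<Sum>j\<in>UNIV. c j *\<^sub>R D j x) \<bullet> h)) (at x)" for x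
    using D(1) by (auto intro!: derivative_eq_intros simp: inner_sum_left)
  moreover have "Ck k (\<lambda>x. (\<Sum>j\<in>UNIV. c j *\<^sub>R D j x) $ i)" for i
    using Suc.IH[of "\<lambda>j x. D j x $ i"] D(2) by (simp add: sum_component)
  moreover have "continuous_on UNIV (\<lambda>x. \<Sum>j\<in>UNIV. c j * f j x)"
    using Suc.prems[THEN Ck_imp_continuous] by (intro continuous_intros)
  ultimately show ?case
    unfolding Ck.simps by (intro conjI exI[of _ "\<lambda>x. \<Sum>j\<in>UNIV. c j *\<^sub>R D j x"] allI)
qed

text \<open>One construction for two objects: with \<open>F\<close> a smooth tower it is the partial
  derivative of order \<open>\<alpha>\<close> of the product kernel, and with
  \<open>F = taylor_power\<close> it is the Taylor monomial z^\<alpha> / \<alpha>!.\<close>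

definition tensor :: "(nat \<Rightarrow> real \<Rightarrow> real) \<Rightarrow> ('n::finite \<Rightarrow> nat) \<Rightarrow> real^'n \<Rightarrow> real" where
  "tensor F \<alpha> z = (\<Prod>i\<in>UNIV. F (\<alpha> i) (z $ i))"

lemma continuous_on_tensor_affine:
  fixes L :: "real^'n \<Rightarrow> real^'n"
  assumes "\<And>a. continuous_on UNIV (F a)" "linear L"
  shows "continuous_on S (\<lambda>y. tensor F \<alpha> (L y - b))"
proof -
  have [continuous_intros]: "continuous_on S L"
    by (intro linear_continuous_on linear_conv_bounded_linear[THEN iffD1] assms(2))
  have "continuous_on S (\<lambda>y. F (\<alpha> i) ((L y - b) $ i))" for i
    by (rule continuous_on_compose2[OF assms(1)]) (auto intro!: continuous_intros)
  then show ?thesis unfolding tensor_def by (intro continuous_intros)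
qed

text \<open>Chain rule: the gradient of the pull-back is the transpose of \<open>L\<close> applied
  to the gradient. \<open>F'\<close> is left arbitrary because differentiation raises the index in a
  smooth tower but lowers it for Taylor powers.\<close>

lemma has_derivative_tensor_affine:
  fixes L :: "real^'n \<Rightarrow> real^'n"
  assumes F: "\<And>a t. (F a has_real_derivative F' a t) (at t)" and L: "linear L"
  shows "((\<lambda>y. tensor F \<alpha> (L y - b)) has_derivative
    (\<lambda>h. adjoint L (\<chi> j. F' (\<alpha> j) ((L y - b) $ j) * (\<Prod>i\<in>UNIV - {j}. F (\<alpha> i) ((L y - b) $ i))) \<bullet> h)) (at y)"
proof -
  have [derivative_intros]: "(L has_derivative L) (at y)"
    using L by (simp add: linear_imp_has_derivative)
  have "((\<lambda>y. F (\<alpha> i) ((L y - b) $ i)) has_derivative (\<lambda>h. L h $ i * F' (\<alpha> i) ((L y - b) $ i))) (at y)" for i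
  proof -
    have "((\<lambda>y. (L y - b) $ i) has_derivative (\<lambda>h. L h $ i)) (at y)"
      by (auto intro!: derivative_eq_intros bounded_linear.has_derivative[OF bounded_linear_vec_nth])
    from DERIV_compose_FDERIV[OF F this] show ?thesis by simp
  qed
  from has_derivative_prod[of UNIV, OF this]
  have "((\<lambda>y. tensor F \<alpha> (L y - b)) has_derivative
    (\<lambda>h. \<Sum>j\<in>UNIV. L h $ j * F' (\<alpha> j) ((L y - b) $ j) * (\<Prod>i\<in>UNIV - {j}. F (\<alpha> i) ((L y - b) $ i)))) (at y)"
    by (simp add: tensor_def)
  moreover have "(\<Sum>j\<in>UNIV. L h $ j * F' (\<alpha> j) ((L y - b) $ j) * (\<Prod>i\<in>UNIV - {j}. F (\<alpha> i) ((L y - b) $ i)))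
     = adjoint L (\<chi> j. F' (\<alpha> j) ((L y - b) $ j) * (\<Prod>i\<in>UNIV - {j}. F (\<alpha> i) ((L y - b) $ i))) \<bullet> h" for h
    using adjoint_works[OF L, of h] by (simp add: inner_commute inner_vec_def mult_ac)
  ultimately show ?thesis by simp
qed

lemma adjoint_component:
  fixes L :: "real^'n \<Rightarrow> real^'n"
  assumes "linear L"
  shows "adjoint L c $ i = (\<Sum>j\<in>UNIV. L (axis i 1) $ j * c $ j)"
proof -
  have "adjoint L c $ i = axis i 1 \<bullet> adjoint L c" by (simp add: inner_axis')
  also have "\<dots> = L (axis i 1) \<bullet> c" by (rule adjoint_works[OF assms])
  finally show ?thesis by (simp add: inner_vec_def)
qed

lemma tensor_upd: "tensor F (\<alpha>(j := a)) z = F a (z $ j) * (\<Prod>i\<in>UNIV - {j}. F (\<alpha> i) (z $ i))"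
  unfolding tensor_def by (subst prod.remove[of UNIV j]) (auto intro!: prod.cong)

lemma has_derivative_tensor_tower:
  fixes L :: "real^'n \<Rightarrow> real^'n"
  assumes F: "\<And>a t. (F a has_real_derivative F (Suc a) t) (at t)" and L: "linear L"
  shows "((\<lambda>y. tensor F \<alpha> (L y - b)) has_derivative
    (\<lambda>h. adjoint L (\<chi> j. tensor F (\<alpha>(j := Suc (\<alpha> j))) (L y - b)) \<bullet> h)) (at y)"
  using has_derivative_tensor_affine[where F = F and F' = "\<lambda>a. F (Suc a)", OF F L] by (simp add: tensor_upd)

text \<open>Partial derivatives are linear combinations of tensors of the same tower with other
  multi-indices, so the induction on \<open>k\<close> is done for all \<open>\<alpha>\<close> at
  once.\<close>

lemma smooth_fun_tensor_tower:
  fixes L :: "real^'n \<Rightarrow> real^'n"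
  assumes F: "\<And>a t. (F a has_real_derivative F (Suc a) t) (at t)" and L: "linear L"
  shows "smooth_fun (\<lambda>y. tensor F \<alpha> (L y - b))"
proof -
  have cont: "continuous_on UNIV (\<lambda>y. tensor F \<alpha> (L y - b))" for \<alpha>
    using F by (intro continuous_on_tensor_affine L) (auto simp: continuous_on_eq_continuous_at intro: DERIV_isCont)
  have "Ck k (\<lambda>y. tensor F \<alpha> (L y - b))" for k
  proof (induction k arbitrary: \<alpha>)
    case 0
    then show ?case using cont by simp
  next
    case (Suc k)
    have "Ck k (\<lambda>y. adjoint L (\<chi> j. tensor F (\<alpha>(j := Suc (\<alpha> j))) (L y - b)) $ i)" for i
      using Ck_sum[where f = "\<lambda>j y. tensor F (\<alpha>(j := Suc (\<alpha> j))) (L y - b)" and c = "\<lambda>j. L (axis i 1) $ j", OF Suc.IH]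
      by (simp add: adjoint_component[OF L])
    then show ?case using cont has_derivative_tensor_tower[where F = F, OF F L]
      by (auto intro!: exI[of _ "\<lambda>y. adjoint L (\<chi> j. tensor F (\<alpha>(j := Suc (\<alpha> j))) (L y - b))"])
  qed
  then show ?thesis by (simp add: smooth_fun_def)
qed

section \<open>Multi-indices and polynomials\<close>

text \<open>The degree is an integer so that differentiation lowers it by one without exception; for
  negative \<open>m\<close> the set is empty.\<close>

definition multi_indices :: "int \<Rightarrow> ('n::finite \<Rightarrow> nat) set" where
  "multi_indices m = {\<alpha>. int (\<Sum>i\<in>UNIV. \<alpha> i) \<le> m}"

lemma multi_indices_iff: "\<alpha> \<in> multi_indices m \<longleftrightarrow> int (\<Sum>i\<in>UNIV. \<alpha> i) \<le> m"
  by (simp add: multi_indices_def)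

lemma finite_multi_indices: "finite (multi_indices m :: ('n::finite \<Rightarrow> nat) set)"
proof (rule finite_subset)
  show "multi_indices m \<subseteq> (PiE UNIV (\<lambda>_. {..nat m}) :: ('n \<Rightarrow> nat) set)"
  proof
    fix \<alpha> :: "'n \<Rightarrow> nat" assume "\<alpha> \<in> multi_indices m"
    then have "(\<Sum>i\<in>UNIV. \<alpha> i) \<le> nat m" by (simp add: multi_indices_iff del: of_nat_sum)
    moreover have "\<alpha> i \<le> (\<Sum>i\<in>UNIV. \<alpha> i)" for i by (rule member_le_sum) auto
    ultimately show "\<alpha> \<in> PiE UNIV (\<lambda>_. {..nat m})"
      by (auto intro: order_trans)
  qed
qed (auto intro: finite_PiE)

lemma multi_index_le: "\<alpha> \<in> multi_indices (int m) \<Longrightarrow> \<alpha> i \<le> m"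
  using member_le_sum[of i UNIV \<alpha>] by (simp add: multi_indices_iff del: of_nat_sum)

definition monomial :: "('n::finite \<Rightarrow> nat) \<Rightarrow> real^'n \<Rightarrow> real" where
  "monomial \<alpha> x = (\<Prod>i\<in>UNIV. (x $ i) ^ \<alpha> i)"

lemma polys_iff: "p \<in> polys m \<longleftrightarrow> (\<exists>c. p = (\<lambda>x. \<Sum>\<alpha>\<in>multi_indices m. c \<alpha> * monomial \<alpha> x))"
  by (simp add: polys_def monomial_def multi_indices_def del: of_nat_sum)

lemma polys_zero: "(\<lambda>x. 0) \<in> polys m"
  unfolding polys_iff by (rule exI[of _ "\<lambda>_. 0"]) simp

lemma polys_add: "p \<in> polys m \<Longrightarrow> q \<in> polys m \<Longrightarrow> (\<lambda>x. p x + q x) \<in> polys m"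
  unfolding polys_iff
proof (elim exE)
  fix c d assume "p = (\<lambda>x. \<Sum>\<alpha>\<in>multi_indices m. c \<alpha> * monomial \<alpha> x)"
    "q = (\<lambda>x. \<Sum>\<alpha>\<in>multi_indices m. d \<alpha> * monomial \<alpha> x)"
  then show "\<exists>e. (\<lambda>x. p x + q x) = (\<lambda>x. \<Sum>\<alpha>\<in>multi_indices m. e \<alpha> * monomial \<alpha> x)"
    by (intro exI[of _ "\<lambda>\<alpha>. c \<alpha> + d \<alpha>"]) (simp add: sum.distrib distrib_right)
qed

lemma polys_scale: "p \<in> polys m \<Longrightarrow> (\<lambda>x. k * p x) \<in> polys m"
  unfolding polys_iff
proof (elim exE)
  fix c assume "p = (\<lambda>x. \<Sum>\<alpha>\<in>multi_indices m. c \<alpha> * monomial \<alpha> x)"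
  then show "\<exists>e. (\<lambda>x. k * p x) = (\<lambda>x. \<Sum>\<alpha>\<in>multi_indices m. e \<alpha> * monomial \<alpha> x)"
    by (intro exI[of _ "\<lambda>\<alpha>. k * c \<alpha>"]) (simp add: sum_distrib_left mult.assoc)
qed

lemma polys_sum: "(\<And>j. j \<in> A \<Longrightarrow> p j \<in> polys m) \<Longrightarrow> (\<lambda>x. \<Sum>j\<in>A. p j x) \<in> polys m"
  by (induction A rule: infinite_finite_induct) (auto intro: polys_zero polys_add)

lemma polys_monomial:
  assumes "\<alpha> \<in> multi_indices m" shows "monomial \<alpha> \<in> polys m"
proof -
  have "(\<lambda>x. \<Sum>\<beta>\<in>multi_indices m. (if \<beta> = \<alpha> then 1 else 0) * monomial \<beta> x) = monomial \<alpha>"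
  proof
    fix x
    have "(\<Sum>\<beta>\<in>multi_indices m. (if \<beta> = \<alpha> then 1 else 0) * monomial \<beta> x)
      = (\<Sum>\<beta>\<in>multi_indices m. if \<beta> = \<alpha> then monomial \<beta> x else 0)"
      by (rule sum.cong) auto
    then show "(\<Sum>\<beta>\<in>multi_indices m. (if \<beta> = \<alpha> then 1 else 0) * monomial \<beta> x) = monomial \<alpha> x"
      by (simp only: sum.delta'[OF finite_multi_indices] sum.delta[OF finite_multi_indices] assms if_True)
  qed
  then show ?thesis
    unfolding polys_iff by (intro exI[of _ "\<lambda>\<beta>. if \<beta> = \<alpha> then 1 else 0"]) (rule sym)
qed

text \<open>Linearity as an induction principle: properties stable under linear combinations need be
  checked on monomials only, and coefficient families drop out of the later proofs.\<close>

lemma polys_induct [consumes 1, case_names zero add scale monomial]: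
  assumes "p \<in> polys m" "Q (\<lambda>x. 0)"
    and "\<And>p q. Q p \<Longrightarrow> Q q \<Longrightarrow> Q (\<lambda>x. p x + q x)"
    and "\<And>k p. Q p \<Longrightarrow> Q (\<lambda>x. k * p x)"
    and "\<And>\<alpha>. \<alpha> \<in> multi_indices m \<Longrightarrow> Q (monomial \<alpha>)"
  shows "Q p"
proof -
  obtain c where p: "p = (\<lambda>x. \<Sum>\<alpha>\<in>multi_indices m. c \<alpha> * monomial \<alpha> x)"
    using assms(1) polys_iff by blast
  have "Q (\<lambda>x. \<Sum>\<alpha>\<in>A. c \<alpha> * monomial \<alpha> x)" if "A \<subseteq> multi_indices m" for A
    using that
  proof (induction A rule: infinite_finite_induct)
    case (insert \<alpha> A)
    have "Q (\<lambda>x. c \<alpha> * monomial \<alpha> x)" using insert.prems by (intro assms(4,5)) simp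
    moreover have "Q (\<lambda>x. \<Sum>\<alpha>\<in>A. c \<alpha> * monomial \<alpha> x)" using insert by simp
    ultimately show ?case using insert.hyps by (simp add: assms(3))
  qed (simp_all add: assms(2))
  then show ?thesis by (simp add: p)
qed

lemma polys_mono: "p \<in> polys m \<Longrightarrow> m \<le> n \<Longrightarrow> p \<in> polys n"
  by (induction p rule: polys_induct) (auto simp: multi_indices_iff intro: polys_zero polys_add polys_scale polys_monomial)

lemma monomial_mult: "monomial \<alpha> x * monomial \<beta> x = monomial (\<lambda>i. \<alpha> i + \<beta> i) x"
  by (simp add: monomial_def power_add prod.distrib)

lemma polys_monomial_mult:
  assumes \<alpha>: "\<alpha> \<in> multi_indices m" and q: "q \<in> polys n"
  shows "(\<lambda>x. monomial \<alpha> x * q x) \<in> polys (m + n)"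
  using q
proof (induction q rule: polys_induct)
  case zero
  show ?case using polys_zero by simp
next
  case (add p q)
  then show ?case using polys_add by (simp add: distrib_left)
next
  case (scale k q)
  then show ?case using polys_scale[OF scale, of k] by (simp only: mult.left_commute)
next
  case (monomial \<beta>)
  then have "(\<lambda>i. \<alpha> i + \<beta> i) \<in> multi_indices (m + n)"
    using \<alpha> by (simp add: multi_indices_iff sum.distrib)
  then show ?case by (simp only: monomial_mult) (rule polys_monomial)
qed

lemma polys_mult:
  assumes p: "p \<in> polys m" and q: "q \<in> polys n" shows "(\<lambda>x. p x * q x) \<in> polys (m + n)"
  using p
proof (induction p rule: polys_induct)
  case zero
  show ?case using polys_zero by simp
next
  case (add p p')
  then show ?case using polys_add by (simp add: distrib_right)
next
  case (scale k p)
  then show ?case using polys_scale[OF scale, of k] by (simp only: mult.assoc)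
next
  case (monomial \<alpha>)
  then show ?case using q by (rule polys_monomial_mult)
qed

lemma polys_const: "0 \<le> m \<Longrightarrow> (\<lambda>x. c) \<in> polys m"
  using polys_scale[OF polys_monomial[of "\<lambda>_. 0" m], of c] by (simp add: monomial_def multi_indices_iff)

lemma polys_coord: "(\<lambda>x. x $ i) \<in> polys 1"
proof -
  have "monomial (\<lambda>j. if j = i then 1 else 0) x = x $ i" for x
    by (simp add: monomial_def if_distrib[of "power _"] cong: if_cong)
  then have "monomial (\<lambda>j. if j = i then 1 else 0) = (\<lambda>x. x $ i)" by auto
  moreover have "(\<lambda>j. if j = i then 1 else 0) \<in> multi_indices 1"
    by (simp add: multi_indices_iff)
  ultimately show ?thesis using polys_monomial by metis
qed

lemma polys_linear_component:
  fixes L :: "real^'n \<Rightarrow> real^'n"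
  assumes "linear L" shows "(\<lambda>x. (L x - b) $ i) \<in> polys 1"
proof -
  have "(\<lambda>x. (\<Sum>j\<in>UNIV. L (axis j 1) $ i * x $ j) + - b $ i) \<in> polys 1"
    by (intro polys_add polys_sum polys_scale polys_coord polys_const) auto
  moreover have "(\<Sum>j\<in>UNIV. L (axis j 1) $ i * x $ j) = L x $ i" for x
  proof -
    have "L x = L (\<Sum>j\<in>UNIV. x $ j *\<^sub>R axis j 1)"
      by (simp only: basis_expansion[of x, unfolded scalar_mult_eq_scaleR])
    also have "\<dots> = (\<Sum>j\<in>UNIV. x $ j *\<^sub>R L (axis j 1))"
      using assms by (simp add: linear_sum linear_scale)
    finally show ?thesis by (simp add: sum_component mult.commute)
  qed
  ultimately show ?thesis by simp
qed

lemma polys_power: "p \<in> polys 1 \<Longrightarrow> (\<lambda>x. p x ^ k) \<in> polys (int k)"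
proof (induction k)
  case 0
  then show ?case by (simp add: polys_const)
next
  case (Suc k)
  then show ?case using polys_mult[OF Suc.prems Suc.IH[OF Suc.prems]] by simp
qed

lemma polys_prod_power:
  assumes "finite A" "\<And>i. i \<in> A \<Longrightarrow> p i \<in> polys 1"
  shows "(\<lambda>x. \<Prod>i\<in>A. p i x ^ \<alpha> i) \<in> polys (int (\<Sum>i\<in>A. \<alpha> i))"
  using assms
proof (induction A)
  case empty
  then show ?case by (simp add: polys_const)
next
  case (insert i A)
  then show ?case using polys_mult[OF polys_power[of "p i" "\<alpha> i"] insert.IH] by simp
qed

lemma polys_compose:
  fixes T :: "real^'n \<Rightarrow> real^'n"
  assumes "R \<in> polys m" "\<And>i. (\<lambda>w. T w $ i) \<in> polys 1"
  shows "(\<lambda>w. R (T w)) \<in> polys m"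
  using assms(1)
proof (induction R rule: polys_induct)
  case (monomial \<alpha>)
  have "(\<lambda>w. monomial \<alpha> (T w)) \<in> polys (int (\<Sum>i\<in>UNIV. \<alpha> i))"
    unfolding monomial_def by (intro polys_prod_power assms(2)) auto
  then show ?case using monomial by (auto simp: multi_indices_iff simp del: of_nat_sum intro: polys_mono)
qed (auto intro: polys_zero polys_add polys_scale)

lemma polys_continuous: "p \<in> polys m \<Longrightarrow> continuous_on S p"
  by (induction p rule: polys_induct) (auto simp: monomial_def intro!: continuous_intros)

section \<open>Taylor sums and their gradients\<close>

text \<open>Dividing by the factorial makes differentiation a pure index shift, the counterpart of
  the opposite shift in a smooth tower.\<close>

definition taylor_power :: "nat \<Rightarrow> real \<Rightarrow> real" where
  "taylor_power a t = t ^ a / fact a"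

lemma tensor_taylor_power: "tensor taylor_power \<alpha> z = monomial \<alpha> z / (\<Prod>i\<in>UNIV. fact (\<alpha> i))"
  by (simp add: tensor_def taylor_power_def monomial_def prod_dividef)

lemma taylor_power_deriv:
  "(taylor_power a has_real_derivative (if a = 0 then 0 else taylor_power (a - 1) t)) (at t)"
proof (cases a)
  case (Suc n)
  have "((\<lambda>t. t ^ Suc n / fact (Suc n)) has_real_derivative real (Suc n) * t ^ n / fact (Suc n)) (at t)"
    by (auto intro!: derivative_eq_intros simp del: fact_Suc of_nat_Suc power_Suc)
  moreover have "real (Suc n) * t ^ n / fact (Suc n) = t ^ n / fact n"
    by (simp del: of_nat_Suc)
  ultimately show ?thesis unfolding taylor_power_def Suc by (simp del: fact_Suc power_Suc)
qed (simp add: taylor_power_def[abs_def])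

lemma sum_fun_upd_nat: "(\<Sum>i\<in>UNIV. (\<alpha>(j := a)) i) + \<alpha> j = (\<Sum>i\<in>UNIV. \<alpha> i) + (a::nat)" for \<alpha> :: "'n::finite \<Rightarrow> nat"
proof -
  have "(\<Sum>i\<in>UNIV. (\<alpha>(j := a)) i) = a + (\<Sum>i\<in>UNIV - {j}. \<alpha> i)"
    by (subst sum.remove[of UNIV j]) (auto intro!: sum.cong)
  moreover have "(\<Sum>i\<in>UNIV. \<alpha> i) = \<alpha> j + (\<Sum>i\<in>UNIV - {j}. \<alpha> i)"
    by (subst sum.remove[of UNIV j]) auto
  ultimately show ?thesis by simp
qed

text \<open>In the j-th reference direction, terms with \<open>\<alpha> j = 0\<close> vanish and the
  others move down by one index. What remains is a Taylor sum of degree \<open>m - 1\<close> whose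
  coefficients are the old ones moved up by one index.\<close>

lemma has_derivative_taylor_sum:
  fixes L :: "real^'n \<Rightarrow> real^'n"
  assumes L: "linear L"
  shows "((\<lambda>y. \<Sum>\<alpha>\<in>multi_indices m. c \<alpha> * tensor taylor_power \<alpha> (L y - b)) has_derivative
    (\<lambda>h. adjoint L (\<chi> j. \<Sum>\<alpha>\<in>multi_indices (m - 1). c (\<alpha>(j := Suc (\<alpha> j))) * tensor taylor_power \<alpha> (L y - b)) \<bullet> h)) (at y)"
proof -
  define d where "d \<alpha> j = (if \<alpha> j = 0 then 0 else tensor taylor_power (\<alpha>(j := \<alpha> j - 1)) (L y - b))" for \<alpha> j
  have d: "((\<lambda>y. tensor taylor_power \<alpha> (L y - b)) has_derivative (\<lambda>h. adjoint L (\<chi> j. d \<alpha> j) \<bullet> h)) (at y)" for \<alpha>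
  proof -
    have "d \<alpha> j = (if \<alpha> j = 0 then 0 else taylor_power (\<alpha> j - 1) ((L y - b) $ j))
        * (\<Prod>i\<in>UNIV - {j}. taylor_power (\<alpha> i) ((L y - b) $ i))" for j
      by (simp add: d_def tensor_upd)
    then show ?thesis
      using has_derivative_tensor_affine[OF taylor_power_deriv L, where \<alpha> = \<alpha> and b = b and y = y] by simp
  qed
  have reindex: "(\<Sum>\<alpha>\<in>multi_indices m. c \<alpha> * d \<alpha> j) =
     (\<Sum>\<alpha>\<in>multi_indices (m - 1). c (\<alpha>(j := Suc (\<alpha> j))) * tensor taylor_power \<alpha> (L y - b))" for j
  proof -
    have "(\<Sum>\<alpha>\<in>multi_indices m. c \<alpha> * d \<alpha> j) = (\<Sum>\<alpha>\<in>{\<alpha>\<in>multi_indices m. \<alpha> j \<noteq> 0}. c \<alpha> * d \<alpha> j)"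
      by (intro sum.mono_neutral_right finite_multi_indices) (auto simp: d_def)
    also have "\<dots> = (\<Sum>\<alpha>\<in>multi_indices (m - 1). c (\<alpha>(j := Suc (\<alpha> j))) * tensor taylor_power \<alpha> (L y - b))"
    proof (rule sum.reindex_bij_witness[where i = "\<lambda>\<alpha>. \<alpha>(j := Suc (\<alpha> j))" and j = "\<lambda>\<alpha>. \<alpha>(j := \<alpha> j - 1)"])
      fix \<alpha> :: "'n \<Rightarrow> nat" assume \<alpha>: "\<alpha> \<in> {\<alpha>\<in>multi_indices m. \<alpha> j \<noteq> 0}"
      then show "\<alpha>(j := \<alpha> j - 1) \<in> multi_indices (m - 1)"
        using sum_fun_upd_nat[where \<alpha> = \<alpha> and j = j and a = "\<alpha> j - 1"]
        by (simp add: multi_indices_iff del: fun_upd_apply of_nat_sum) linarith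
    next
      fix \<alpha> :: "'n \<Rightarrow> nat" assume "\<alpha> \<in> multi_indices (m - 1)"
      then show "\<alpha>(j := Suc (\<alpha> j)) \<in> {\<alpha>\<in>multi_indices m. \<alpha> j \<noteq> 0}"
        using sum_fun_upd_nat[where \<alpha> = \<alpha> and j = j and a = "Suc (\<alpha> j)"]
        by (simp add: multi_indices_iff del: fun_upd_apply of_nat_sum) simp
    qed (auto simp: d_def)
    finally show ?thesis .
  qed
  have "((\<lambda>y. \<Sum>\<alpha>\<in>multi_indices m. c \<alpha> * tensor taylor_power \<alpha> (L y - b)) has_derivative
    (\<lambda>h. \<Sum>\<alpha>\<in>multi_indices m. c \<alpha> * (adjoint L (\<chi> j. d \<alpha> j) \<bullet> h))) (at y)"
    by (intro has_derivative_sum has_derivative_mult_right d)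
  moreover have "(\<Sum>\<alpha>\<in>multi_indices m. c \<alpha> * (adjoint L (\<chi> j. d \<alpha> j) \<bullet> h)) =
    adjoint L (\<chi> j. \<Sum>\<alpha>\<in>multi_indices m. c \<alpha> * d \<alpha> j) \<bullet> h" for h
  proof -
    have "adjoint L u \<bullet> h = (\<Sum>j\<in>UNIV. u $ j * L h $ j)" for u
      using adjoint_works[OF L, of h u] by (simp add: inner_commute inner_vec_def mult_ac)
    then show ?thesis
      by (simp add: sum_distrib_left sum_distrib_right mult.assoc) (rule sum.swap)
  qed
  ultimately show ?thesis by (simp add: reindex)
qed

subsection \<open>Simplices and square-integrable functions\<close>

text \<open>\<open>L\<close> sends the edges at a vertex \<open>x0\<close> to the unit vectors, and
  \<open>b\<close> moves the barycentre to the origin. In these coordinates every simplex is the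
  same translated standard simplex, so the inscribed and circumscribed cubes depend on the dimension
  only.\<close>

lemma simplex_affine_coordinates:
  fixes K :: "(real^'n) set"
  assumes "int CARD('n) simplex K"
  obtains L :: "real^'n \<Rightarrow> real^'n" and b where "linear L" "surj L"
    "{y. \<forall>i. \<bar>(L y - b) $ i\<bar> < 1 / (real CARD('n) * (real CARD('n) + 1))} \<subseteq> K"
    "\<And>y i. y \<in> K \<Longrightarrow> \<bar>(L y - b) $ i\<bar> \<le> 1"
proof -
  obtain C where C: "\<not> affine_dependent C" "int (card C) = int CARD('n) + 1" "K = convex hull C"
    using assms by (auto simp: simplex_def)
  have fin: "finite C" using C(1) aff_independent_finite by blast
  have "C \<noteq> {}" using C(2) by auto
  then obtain x0 where x0: "x0 \<in> C" by blast
  define V where "V = (\<lambda>x. x - x0) ` (C - {x0})"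
  have indep: "independent V"
    using C(1) x0 affine_dependent_iff_dependent2[OF x0] by (simp add: V_def)
  have "card V = CARD('n)"
    using C(2) x0 fin by (simp add: V_def card_image inj_on_def)
  then obtain e where e: "bij_betw e (UNIV :: 'n set) V"
    using finite_same_card_bij[of "UNIV :: 'n set" V] fin by (auto simp: V_def)
  obtain L :: "real^'n \<Rightarrow> real^'n" where L: "linear L" and LV: "\<And>v. v \<in> V \<Longrightarrow> L v = axis (inv e v) 1"
    using linear_independent_extend[OF indep, of "\<lambda>v. axis (inv e v) 1"] by blast
  have Le: "L (e i) = axis i 1" for i
    using LV[of "e i"] e by (auto simp: bij_betw_def)
  have rep: "L (\<Sum>i\<in>UNIV. w $ i *\<^sub>R e i) = w" for w
  proof -
    have "L (\<Sum>i\<in>UNIV. w $ i *\<^sub>R e i) = (\<Sum>i\<in>UNIV. w $ i *s axis i 1)"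
      by (simp only: linear_sum[OF L] linear_scale[OF L] Le scalar_mult_eq_scaleR)
    then show ?thesis by (simp only: basis_expansion)
  qed
  have surj: "surj L" by (rule surjI[where f = "\<lambda>w. \<Sum>i\<in>UNIV. w $ i *\<^sub>R e i", OF rep])
  have inj: "inj L" using L surj by (simp add: linear_surjective_imp_injective)
  define n where "n = real CARD('n)"
  have n: "n \<ge> 1" by (simp add: n_def Suc_leI)
  \<comment> \<open>Each coordinate of the barycentre of the standard simplex. A deviation below
    \<open>\<kappa> / n\<close> keeps every coordinate nonnegative and at most
    \<open>\<kappa> + \<kappa> / n = 1 / n\<close>, hence their sum at most 1.\<close>
  define \<kappa> where "\<kappa> = 1 / (n + 1)"
  define b where "b = L x0 + (\<chi> i. \<kappa>)"
  have b: "(L y - b) $ i = L (y - x0) $ i - \<kappa>" for y i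
    by (simp add: b_def linear_diff[OF L])
  have xe: "x0 + e i \<in> K" for i
  proof -
    have "e i \<in> V" using e by (auto simp: bij_betw_def)
    then have "x0 + e i \<in> C" by (auto simp: V_def)
    then show ?thesis using C(3) hull_inc by metis
  qed
  have "y \<in> K" if y: "\<And>i. \<bar>(L y - b) $ i\<bar> < 1 / (n * (n + 1))" for y
  proof -
    define t where "t = L (y - x0)"
    have t: "\<bar>t $ i - \<kappa>\<bar> < \<kappa> / n" for i
      using y[of i] unfolding b t_def by (simp add: \<kappa>_def mult.commute)
    have "\<kappa> / n \<le> \<kappa> / 1" using n by (intro divide_left_mono) (auto simp: \<kappa>_def)
    then have t0: "0 \<le> t $ i" for i using t[of i] by linarith
    have "t $ i \<le> 1 / n" for i
    proof -
      have "\<kappa> + \<kappa> / n = \<kappa> * (n + 1) / n" using n by (simp add: field_simps)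
      also have "\<kappa> * (n + 1) = 1" using n by (simp add: \<kappa>_def)
      finally have "\<kappa> + \<kappa> / n = 1 / n" .
      then show ?thesis using t[of i] by linarith
    qed
    then have "(\<Sum>i\<in>UNIV. t $ i) \<le> (\<Sum>i\<in>(UNIV :: 'n set). 1 / n)" by (intro sum_mono) auto
    then have t1: "(\<Sum>i\<in>UNIV. t $ i) \<le> 1" by (simp add: n_def)
    have "L (y - x0) = L (\<Sum>i\<in>UNIV. t $ i *\<^sub>R e i)" by (simp add: rep t_def)
    then have y_eq: "y = x0 + (\<Sum>i\<in>UNIV. t $ i *\<^sub>R e i)"
      using inj by (simp add: inj_eq algebra_simps)
    \<comment> \<open>Barycentric coordinates of \<open>y\<close>: the option type indexes the n + 1
      vertices, with \<open>None\<close> for \<open>x0\<close>.\<close>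
    define u where "u = case_option (1 - (\<Sum>i\<in>UNIV. t $ i)) (($) t)"
    define p where "p = case_option x0 (\<lambda>i. x0 + e i)"
    have split: "(\<Sum>k\<in>UNIV. h k) = h None + (\<Sum>i\<in>UNIV. h (Some i))" for h :: "'n option \<Rightarrow> 'c::comm_monoid_add"
      by (simp add: UNIV_option_conv sum.reindex)
    have "(\<Sum>k\<in>UNIV. u k *\<^sub>R p k) \<in> K"
    proof (rule convex_sum)
      show "convex K" using C(3) by simp
      show "(\<Sum>k\<in>UNIV. u k) = 1" by (simp add: split u_def)
      show "\<And>k. k \<in> UNIV \<Longrightarrow> 0 \<le> u k" using t0 t1 by (auto simp: u_def split: option.split)
      show "\<And>k. k \<in> UNIV \<Longrightarrow> p k \<in> K"
        using xe x0 C(3) by (auto simp: p_def hull_inc split: option.split)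
    qed simp
    moreover have "(\<Sum>k\<in>UNIV. u k *\<^sub>R p k) = y"
      by (subst y_eq)
        (simp add: split u_def p_def scaleR_add_right sum.distrib scaleR_sum_left[symmetric] scaleR_left_diff_distrib)
    ultimately show ?thesis by simp
  qed
  then have inner: "{y. \<forall>i. \<bar>(L y - b) $ i\<bar> < 1 / (real CARD('n) * (real CARD('n) + 1))} \<subseteq> K"
    by (auto simp: n_def)
  \<comment> \<open>The preimage of a cube under \<open>L\<close> is convex, so checking the
    vertices is enough.\<close>
  have "K \<subseteq> L -` cbox (L x0) (L x0 + 1)"
    unfolding C(3)
  proof (rule hull_minimal)
    show "convex (L -` cbox (L x0) (L x0 + 1))"
      using L by (intro convex_linear_vimage) auto
    show "C \<subseteq> L -` cbox (L x0) (L x0 + 1)"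
    proof
      fix x assume x: "x \<in> C"
      show "x \<in> L -` cbox (L x0) (L x0 + 1)"
      proof (cases "x = x0")
        case False
        then have "x - x0 \<in> V" using x by (auto simp: V_def)
        then have "L x = L x0 + axis (inv e (x - x0)) 1"
          using LV[of "x - x0"] by (simp add: linear_diff[OF L] algebra_simps)
        then show ?thesis by (simp add: mem_box_cart axis_def)
      qed (simp add: mem_box_cart)
    qed
  qed
  then have t01: "0 \<le> L (y - x0) $ i" "L (y - x0) $ i \<le> 1" if "y \<in> K" for y i
  proof -
    have "L y \<in> cbox (L x0) (L x0 + 1)" using \<open>K \<subseteq> _\<close> that by blast
    then have "L x0 $ i \<le> L y $ i \<and> L y $ i \<le> L x0 $ i + 1" by (simp add: mem_box_cart)
    then show "0 \<le> L (y - x0) $ i" "L (y - x0) $ i \<le> 1" by (simp_all add: linear_diff[OF L])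
  qed
  have "\<bar>(L y - b) $ i\<bar> \<le> 1" if "y \<in> K" for y i
  proof -
    have "0 \<le> \<kappa>" "\<kappa> \<le> 1" using n by (auto simp: \<kappa>_def)
    then show ?thesis using t01[OF that, of i] unfolding b by linarith
  qed
  then show thesis using that[OF L surj inner] by blast
qed

section \<open>Integral estimates on sets of finite measure\<close>

lemma LINT_lebesgue_on: "K \<in> sets lebesgue \<Longrightarrow> (LINT x:K|lebesgue. f x) = integral\<^sup>L (lebesgue_on K) f"
  for f :: "'a::euclidean_space \<Rightarrow> real"
  by (simp add: set_lebesgue_integral_def integral_restrict_space)

lemma set_integrable_lebesgue_on: "K \<in> sets lebesgue \<Longrightarrow> set_integrable lebesgue K f \<longleftrightarrow> integrable (lebesgue_on K) f"
  for f :: "'a::euclidean_space \<Rightarrow> real"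
  by (simp add: set_integrable_def integrable_restrict_space)

context finite_measure
begin

lemma integrable_of_square_integrable:
  fixes f :: "'a \<Rightarrow> real"
  assumes "f \<in> borel_measurable M" "integrable M (\<lambda>x. (f x)\<^sup>2)"
  shows "integrable M f"
proof (rule Bochner_Integration.integrable_bound)
  show "integrable M (\<lambda>x. 1 + (f x)\<^sup>2)" using assms by simp
  have "\<bar>t\<bar> \<le> 1 + t\<^sup>2" for t :: real
  proof -
    have "0 \<le> (\<bar>t\<bar> - 1 / 2)\<^sup>2" by simp
    then show ?thesis by (simp add: power2_eq_square algebra_simps)
  qed
  then show "AE x in M. norm (f x) \<le> norm (1 + (f x)\<^sup>2)" by simp
qed (rule assms)

text \<open>Cauchy-Schwarz from the nonnegativity of the integral of (|f| - t)^2 at t = a / \<mu>. A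
  bound \<open>\<mu>\<close> replaces the measure itself because the volume of the simplex is only
  estimated from above.\<close>

lemma L1_le_L2:
  fixes f :: "'a \<Rightarrow> real"
  assumes f: "f \<in> borel_measurable M" "integrable M (\<lambda>x. (f x)\<^sup>2)"
    and \<mu>: "measure M (space M) \<le> \<mu>" "\<mu> > 0"
  shows "(LINT x|M. \<bar>f x\<bar>)\<^sup>2 \<le> \<mu> * (LINT x|M. (f x)\<^sup>2)"
proof -
  define a where "a = (LINT x|M. \<bar>f x\<bar>)"
  define t where "t = a / \<mu>"
  have int: "integrable M (\<lambda>x. \<bar>f x\<bar>)" using integrable_of_square_integrable[OF f] by simp
  have "0 \<le> (LINT x|M. (\<bar>f x\<bar> - t)\<^sup>2)" by simp
  also have "\<dots> = (LINT x|M. (f x)\<^sup>2 + (t\<^sup>2 - 2 * t * \<bar>f x\<bar>))"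
    by (simp add: power2_diff algebra_simps)
  also have "\<dots> = (LINT x|M. (f x)\<^sup>2) + (t\<^sup>2 * measure M (space M) - 2 * t * a)"
    using int f(2) by (simp add: a_def mult.commute)
  finally have "2 * t * a \<le> (LINT x|M. (f x)\<^sup>2) + t\<^sup>2 * \<mu>"
    using mult_left_mono[OF \<mu>(1), of "t\<^sup>2"] by simp
  then show ?thesis using \<mu>(2)
    by (simp add: t_def a_def[symmetric] power2_eq_square field_simps)
qed

text \<open>A pointwise bound by \<open>s\<close> times the L1 norm becomes an L2 bound with
  constant \<open>s * \<mu>\<close>. Only this product enters, which later lets the Jacobian cancel
  between its two factors.\<close>

lemma square_integral_diff_bound:
  fixes f p :: "'a \<Rightarrow> real"
  assumes f: "f \<in> borel_measurable M" "integrable M (\<lambda>x. (f x)\<^sup>2)"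
    and p: "p \<in> borel_measurable M" "\<And>x. x \<in> space M \<Longrightarrow> \<bar>p x\<bar> \<le> s * (LINT x|M. \<bar>f x\<bar>)"
    and \<mu>: "measure M (space M) \<le> \<mu>" "\<mu> > 0"
  shows "integrable M (\<lambda>x. (f x - p x)\<^sup>2)"
    and "(LINT x|M. (f x - p x)\<^sup>2) \<le> (2 + 2 * (s * \<mu>)\<^sup>2) * (LINT x|M. (f x)\<^sup>2)"
proof -
  define a where "a = (LINT x|M. \<bar>f x\<bar>)"
  have ptw: "(f x - p x)\<^sup>2 \<le> 2 * (f x)\<^sup>2 + 2 * (s * a)\<^sup>2" if "x \<in> space M" for x
  proof -
    have "(p x)\<^sup>2 \<le> (s * a)\<^sup>2" using p(2)[OF that] by (metis a_def abs_ge_zero power2_abs power_mono)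
    moreover have "0 \<le> (f x + p x)\<^sup>2" by simp
    ultimately show ?thesis by (simp add: power2_diff power2_sum)
  qed
  have int: "integrable M (\<lambda>x. 2 * (f x)\<^sup>2 + 2 * (s * a)\<^sup>2)" using f(2) by simp
  show *: "integrable M (\<lambda>x. (f x - p x)\<^sup>2)"
  proof (rule Bochner_Integration.integrable_bound[OF int])
    show "(\<lambda>x. (f x - p x)\<^sup>2) \<in> borel_measurable M" using f(1) p(1) by measurable
    show "AE x in M. norm ((f x - p x)\<^sup>2) \<le> norm (2 * (f x)\<^sup>2 + 2 * (s * a)\<^sup>2)"
    proof (rule AE_I2)
      fix x assume "x \<in> space M"
      from ptw[OF this] show "norm ((f x - p x)\<^sup>2) \<le> norm (2 * (f x)\<^sup>2 + 2 * (s * a)\<^sup>2)"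
        by (simp only: real_norm_def abs_power2 abs_of_nonneg[OF add_nonneg_nonneg] zero_le_power2 zero_le_numeral mult_nonneg_nonneg)
    qed
  qed
  have "(LINT x|M. (f x - p x)\<^sup>2) \<le> (LINT x|M. 2 * (f x)\<^sup>2 + 2 * (s * a)\<^sup>2)"
    by (rule integral_mono[OF * int]) (rule ptw)
  also have "\<dots> = 2 * (LINT x|M. (f x)\<^sup>2) + 2 * (s * a)\<^sup>2 * measure M (space M)"
    using f(2) by simp
  also have "\<dots> \<le> 2 * (LINT x|M. (f x)\<^sup>2) + 2 * (s * a)\<^sup>2 * \<mu>"
    using \<mu> by (intro add_left_mono mult_left_mono) auto
  also have "\<dots> = 2 * (LINT x|M. (f x)\<^sup>2) + 2 * s\<^sup>2 * \<mu> * a\<^sup>2"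
    by (simp add: power_mult_distrib)
  also have "\<dots> \<le> 2 * (LINT x|M. (f x)\<^sup>2) + 2 * s\<^sup>2 * \<mu> * (\<mu> * (LINT x|M. (f x)\<^sup>2))"
    unfolding a_def using \<mu> by (intro add_left_mono mult_left_mono L1_le_L2 f) auto
  finally show "(LINT x|M. (f x - p x)\<^sup>2) \<le> (2 + 2 * (s * \<mu>)\<^sup>2) * (LINT x|M. (f x)\<^sup>2)"
    by (simp add: power2_eq_square algebra_simps)
qed

end

lemma finite_measure_lebesgue_on_compact: "compact K \<Longrightarrow> finite_measure (lebesgue_on K)"
  for K :: "'a::euclidean_space set"
  by (intro finite_measure_lebesgue_on lmeasurable_compact)

lemma measurable_lebesgue_on_continuous:
  fixes h :: "'a::euclidean_space \<Rightarrow> real"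
  assumes "compact K" "continuous_on K h"
  shows "h \<in> borel_measurable (lebesgue_on K)"
  using assms by (intro continuous_imp_measurable_on_sets_lebesgue) (auto intro: fmeasurableD lmeasurable_compact)

lemma integrable_L2_mult_continuous:
  fixes f h :: "real^'n \<Rightarrow> real"
  assumes K: "compact K" and f: "L2_on K f" and h: "continuous_on K h"
  shows "integrable (lebesgue_on K) (\<lambda>x. f x * h x)"
proof -
  have KS: "K \<in> sets lebesgue" using K by (intro fmeasurableD lmeasurable_compact)
  interpret finite_measure "lebesgue_on K" by (rule finite_measure_lebesgue_on_compact[OF K])
  have fi: "integrable (lebesgue_on K) f"
    using f KS by - (rule integrable_of_square_integrable; auto simp: L2_on_def set_integrable_lebesgue_on)
  have "bounded (h ` K)" using K h by (intro compact_imp_bounded compact_continuous_image)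
  then obtain B where B: "\<And>x. x \<in> K \<Longrightarrow> \<bar>h x\<bar> \<le> B"
    unfolding bounded_iff by (metis imageI real_norm_def)
  show ?thesis
  proof (rule Bochner_Integration.integrable_bound)
    show "integrable (lebesgue_on K) (\<lambda>x. B * f x)" using fi by simp
    show "(\<lambda>x. f x * h x) \<in> borel_measurable (lebesgue_on K)"
      using f measurable_lebesgue_on_continuous[OF K h] by (auto simp: L2_on_def)
    show "AE x in lebesgue_on K. norm (f x * h x) \<le> norm (B * f x)"
    proof (rule AE_I2)
      fix x assume "x \<in> space (lebesgue_on K)"
      then have "\<bar>h x\<bar> \<le> \<bar>B\<bar>" using B[of x] by (auto simp: space_restrict_space)
      then show "norm (f x * h x) \<le> norm (B * f x)"
        using mult_left_mono[of "\<bar>h x\<bar>" "\<bar>B\<bar>" "\<bar>f x\<bar>"] by (simp add: abs_mult mult.commute)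
    qed
  qed
qed

lemma L2_on_continuous:
  fixes h :: "real^'n \<Rightarrow> real"
  assumes "compact K" "continuous_on K h"
  shows "L2_on K h"
proof -
  have KS: "K \<in> sets lebesgue" using assms(1) by (intro fmeasurableD lmeasurable_compact)
  interpret finite_measure "lebesgue_on K" by (rule finite_measure_lebesgue_on_compact[OF assms(1)])
  have "bounded ((\<lambda>x. (h x)\<^sup>2) ` K)"
    by (rule compact_imp_bounded[OF compact_continuous_image[OF _ assms(1)]])
      (rule continuous_on_power[OF assms(2)])
  then obtain B where "\<And>x. x \<in> K \<Longrightarrow> \<bar>(h x)\<^sup>2\<bar> \<le> B"
    unfolding bounded_iff by (metis (no_types, lifting) imageI real_norm_def)
  then have "integrable (lebesgue_on K) (\<lambda>x. (h x)\<^sup>2)"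
    using measurable_lebesgue_on_continuous[OF assms]
    by (intro integrable_const_bound[where B = B]) (auto simp: space_restrict_space intro!: AE_I2)
  then show ?thesis
    using measurable_lebesgue_on_continuous[OF assms] KS by (simp add: L2_on_def set_integrable_lebesgue_on)
qed

lemma L2_on_diff_continuous:
  fixes f h :: "real^'n \<Rightarrow> real"
  assumes K: "compact K" and f: "L2_on K f" and h: "continuous_on K h"
  shows "L2_on K (\<lambda>x. f x - h x)"
proof -
  have KS: "K \<in> sets lebesgue" using assms(1) by (intro fmeasurableD lmeasurable_compact)
  have h2: "L2_on K h" by (rule L2_on_continuous[OF K h])
  have "integrable (lebesgue_on K) (\<lambda>x. (f x)\<^sup>2 + (h x)\<^sup>2 - 2 * (f x * h x))"
    using f h2 KS integrable_L2_mult_continuous[OF K f h]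
    by (intro Bochner_Integration.integrable_diff Bochner_Integration.integrable_add integrable_mult_right)
      (auto simp: L2_on_def set_integrable_lebesgue_on)
  then have "integrable (lebesgue_on K) (\<lambda>x. (f x - h x)\<^sup>2)"
    by (simp add: power2_diff mult.assoc)
  then show ?thesis using f h2 KS by (auto simp: L2_on_def set_integrable_lebesgue_on)
qed

subsection \<open>The projection\<close>

text \<open>All that the estimates use of a simplex: affine coordinates with Jacobian
  \<open>J\<close>, a cube inside and a cube outside. The gap between \<open>\<rho>\<close> and
  \<open>r\<close> keeps the closed support of the kernel in the interior of
  \<open>K\<close>.\<close>

locale affine_coordinates =
  fixes K :: "(real^'n) set" and L :: "real^'n \<Rightarrow> real^'n" and b :: "real^'n" and J r \<rho> :: real
    and \<eta> :: "nat \<Rightarrow> real \<Rightarrow> real" and l :: nat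
  assumes compact_K: "compact K" and linear_L: "linear L" and surj_L: "surj L" and J_pos: "J > 0"
    and J: "\<And>A. A \<in> sets borel \<Longrightarrow> emeasure lborel ((\<lambda>y. L y - b) -` A) = ennreal (1 / J) * emeasure lborel A"
    and inner: "{y. \<forall>i. \<bar>(L y - b) $ i\<bar> < r} \<subseteq> K"
    and outer: "\<And>y i. y \<in> K \<Longrightarrow> \<bar>(L y - b) $ i\<bar> \<le> 1"
    and \<rho>: "\<rho> < r" and \<eta>: "smooth_tower \<rho> \<eta>"
    and moment: "\<And>a k. k \<le> l \<Longrightarrow> (-1) ^ a * (LINT t|lborel. \<eta> a t * t ^ k) = (if a = k then fact a else 0)"
begin

text \<open>The derivative of order \<open>\<alpha>\<close> at the origin of \<open>f\<close>,
  written in the coordinates w = L y - b and mollified with the reflected kernel. The sign comes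
  from differentiating that kernel, and \<open>J\<close> from the change of variables.\<close>

definition coeff :: "(real^'n \<Rightarrow> real) \<Rightarrow> ('n \<Rightarrow> nat) \<Rightarrow> real" where
  "coeff f \<alpha> = J * (-1) ^ (\<Sum>i\<in>UNIV. \<alpha> i) * (LINT y|lebesgue_on K. f y * tensor \<eta> \<alpha> (L y - b))"

definition taylor :: "int \<Rightarrow> (real^'n \<Rightarrow> real) \<Rightarrow> real^'n \<Rightarrow> real" where
  "taylor m f x = (\<Sum>\<alpha>\<in>multi_indices m. coeff f \<alpha> * tensor taylor_power \<alpha> (L x - b))"

lemma sets_K: "K \<in> sets lebesgue"
  using compact_K by (intro fmeasurableD lmeasurable_compact)

lemma \<eta>_deriv: "(\<eta> a has_real_derivative \<eta> (Suc a) t) (at t)"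
  using \<eta> by (simp add: smooth_tower_def)

lemma continuous_L: "continuous_on S L"
  by (intro linear_continuous_on linear_conv_bounded_linear[THEN iffD1] linear_L)

lemma continuous_component: "continuous_on S (\<lambda>y. (L y - b) $ i)"
  by (intro continuous_intros continuous_L)

lemma continuous_tensor: "continuous_on S (\<lambda>y. tensor \<eta> \<alpha> (L y - b))"
  by (rule continuous_on_tensor_affine[OF smooth_tower_continuous[OF \<eta>] linear_L])

lemma tensor_support:
  assumes "tensor \<eta> \<alpha> (L y - b) \<noteq> 0" shows "\<bar>(L y - b) $ i\<bar> < \<rho>"
proof (rule ccontr)
  assume "\<not> \<bar>(L y - b) $ i\<bar> < \<rho>"
  then have "\<eta> (\<alpha> i) ((L y - b) $ i) = 0" using \<eta> by (simp add: smooth_tower_def del: vector_minus_component)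
  then have "(\<Prod>i\<in>UNIV. \<eta> (\<alpha> i) ((L y - b) $ i)) = 0" by (intro prod_zero) auto
  then show False using assms by (simp only: tensor_def)
qed

text \<open>Allows integrals against the kernel over \<open>K\<close> to be taken over the whole
  space, where they factor into one-dimensional integrals.\<close>

lemma tensor_eq_0: "y \<notin> K \<Longrightarrow> tensor \<eta> \<alpha> (L y - b) = 0"
  using subsetD[OF inner CollectI] less_trans[OF tensor_support \<rho>] by blast

lemma test_fun_tensor: "test_fun K (\<lambda>y. tensor \<eta> \<alpha> (L y - b))"
proof -
  let ?S = "{y. tensor \<eta> \<alpha> (L y - b) \<noteq> 0}"
  have "closed {y. \<forall>i. \<bar>(L y - b) $ i\<bar> \<le> \<rho>}"
    by (intro closed_Collect_all closed_Collect_le continuous_on_rabs continuous_component continuous_on_const)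
  then have "closure ?S \<subseteq> {y. \<forall>i. \<bar>(L y - b) $ i\<bar> \<le> \<rho>}"
    using tensor_support by (intro closure_minimal) (auto intro: less_imp_le simp del: vector_minus_component)
  also have "\<dots> \<subseteq> {y. \<forall>i. \<bar>(L y - b) $ i\<bar> < r}"
    by (blast intro: le_less_trans[OF _ \<rho>])
  also have "\<dots> \<subseteq> interior K"
  proof (rule interior_maximal[OF inner])
    have "{y. \<forall>i. \<bar>(L y - b) $ i\<bar> < r} = (\<Inter>i. {y. \<bar>(L y - b) $ i\<bar> < r})" by auto
    moreover have "open (\<Inter>i. {y. \<bar>(L y - b) $ i\<bar> < r})"
      by (intro open_INT ballI open_Collect_less continuous_on_rabs continuous_component continuous_on_const) auto
    ultimately show "open {y. \<forall>i. \<bar>(L y - b) $ i\<bar> < r}" by simp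
  qed
  finally have sub: "closure ?S \<subseteq> interior K" .
  then have "closure ?S \<subseteq> K" using interior_subset by blast
  then have "compact (closure ?S)"
    using compact_K by (meson bounded_subset closed_closure compact_eq_bounded_closed)
  moreover have "smooth_fun (\<lambda>y. tensor \<eta> \<alpha> (L y - b))"
    by (rule smooth_fun_tensor_tower[where F = \<eta>, OF \<eta>_deriv linear_L])
  ultimately show ?thesis using sub by (simp add: test_fun_def)
qed

lemma integrable_tensor: "L2_on K f \<Longrightarrow> integrable (lebesgue_on K) (\<lambda>y. f y * tensor \<eta> \<alpha> (L y - b))"
  by (rule integrable_L2_mult_continuous[OF compact_K _ continuous_tensor])

lemma taylor_add:
  assumes "L2_on K f" "L2_on K g"
  shows "taylor m (\<lambda>y. f y + g y) x = taylor m f x + taylor m g x"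
proof -
  have "coeff (\<lambda>y. f y + g y) \<alpha> = coeff f \<alpha> + coeff g \<alpha>" for \<alpha>
    using assms[THEN integrable_tensor] by (simp add: coeff_def distrib_right distrib_left)
  then show ?thesis by (simp add: taylor_def distrib_right sum.distrib)
qed

lemma taylor_scale: "taylor m (\<lambda>y. k * f y) x = k * taylor m f x"
proof -
  have "coeff (\<lambda>y. k * f y) \<alpha> = k * coeff f \<alpha>" for \<alpha>
    by (simp add: coeff_def mult.assoc mult.left_commute)
  then show ?thesis by (simp add: taylor_def sum_distrib_left mult.assoc)
qed

text \<open>The integral extends to the whole space, the factor \<open>J\<close> cancels in the
  change of variables, and Fubini leaves a product of one-dimensional moments. A single coordinate
  with \<open>\<alpha> i \<noteq> \<beta> i\<close> makes it zero.\<close>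

lemma coeff_monomial:
  assumes "\<beta> \<in> multi_indices (int l)"
  shows "coeff (\<lambda>y. monomial \<beta> (L y - b)) \<alpha> = (if \<alpha> = \<beta> then (\<Prod>i\<in>UNIV. fact (\<alpha> i)) else 0)"
proof -
  define F where "F w = (\<Prod>i\<in>UNIV. \<eta> (\<alpha> i) (w $ i) * (w $ i) ^ \<beta> i)" for w :: "real^'n"
  have F: "monomial \<beta> w * tensor \<eta> \<alpha> w = F w" for w
    by (simp add: F_def monomial_def tensor_def prod.distrib mult.commute)
  have contF: "continuous_on UNIV F"
    unfolding F_def
    by (intro continuous_intros continuous_on_compose2[OF smooth_tower_continuous[OF \<eta>]]) auto
  have meas: "F \<in> borel_measurable borel" by (rule borel_measurable_continuous_onI[OF contF])
  have "continuous_on UNIV (\<lambda>y. F (L y - b))"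
    by (rule continuous_on_compose2[OF contF]) (auto intro!: continuous_intros continuous_L)
  then have meas2: "(\<lambda>y. F (L y - b)) \<in> borel_measurable borel" by (rule borel_measurable_continuous_onI)
  have "(LINT y|lebesgue_on K. monomial \<beta> (L y - b) * tensor \<eta> \<alpha> (L y - b))
      = (LINT y|lebesgue. indicator K y *\<^sub>R F (L y - b))"
    using sets_K by (simp add: integral_restrict_space F)
  also have "\<dots> = (LINT y|lebesgue. F (L y - b))"
  proof (rule Bochner_Integration.integral_cong[OF refl])
    fix y
    show "indicator K y *\<^sub>R F (L y - b) = F (L y - b)"
      using tensor_eq_0[of y \<alpha>] by (cases "y \<in> K") (auto simp: F[symmetric])
  qed
  also have "\<dots> = (LINT y|lborel. F (L y - b))"
    using meas2 by (intro integral_completion) simp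
  finally have "J * (LINT y|lebesgue_on K. monomial \<beta> (L y - b) * tensor \<eta> \<alpha> (L y - b)) = (LINT w|lborel. F w)"
    using lborel_integral_affine[OF linear_L J_pos J meas] by simp
  also have "\<dots> = (\<Prod>i\<in>UNIV. LINT t|lborel. \<eta> (\<alpha> i) t * t ^ \<beta> i)"
    unfolding F_def
    by (rule lborel_integral_prod_cart) (rule integrable_smooth_tower_moment[OF \<eta>])
  finally have "coeff (\<lambda>y. monomial \<beta> (L y - b)) \<alpha>
     = (\<Prod>i\<in>UNIV. (-1) ^ \<alpha> i * (LINT t|lborel. \<eta> (\<alpha> i) t * t ^ \<beta> i))"
    by (simp add: coeff_def power_sum prod.distrib mult.assoc mult.left_commute)
  also have "\<dots> = (\<Prod>i\<in>UNIV. if \<alpha> i = \<beta> i then fact (\<alpha> i) else 0)"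
    using multi_index_le[OF assms] by (intro prod.cong refl moment)
  also have "\<dots> = (if \<alpha> = \<beta> then (\<Prod>i\<in>UNIV. fact (\<alpha> i)) else 0)"
  proof (cases "\<alpha> = \<beta>")
    case False
    then obtain i where "\<alpha> i \<noteq> \<beta> i" by blast
    then show ?thesis using False by (auto intro!: prod_zero bexI[of _ i])
  qed simp
  finally show ?thesis .
qed

text \<open>The inverse affine map turns \<open>R\<close> into a polynomial in w = L y - b of the
  same degree bound. On monomials in w the factorials of \<open>coeff_monomial\<close> cancel those
  of the Taylor powers; linearity does the rest.\<close>

lemma taylor_reproduces:
  assumes R: "R \<in> polys m" and m: "m \<le> int l"
  shows "taylor m R x = R x"
proof -
  obtain L' where L': "linear L'" "\<And>x. L' (L x) = x"
    using linear_injective_left_inverse[OF linear_L linear_surjective_imp_injective[OF linear_L surj_L]]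
    by (metis comp_apply id_apply)
  define T where "T w = L' w - - L' b" for w
  have T: "T (L y - b) = y" for y by (simp add: T_def linear_diff[OF L'(1)] L'(2))
  have "(\<lambda>w. R (T w)) \<in> polys m"
    unfolding T_def by (rule polys_compose[OF R polys_linear_component[OF L'(1)]])
  \<comment> \<open>Continuity is carried along because additivity of \<open>taylor\<close> requires
    square-integrable summands on \<open>K\<close>.\<close>
  moreover have "continuous_on UNIV p \<and> (\<forall>x. taylor m (\<lambda>y. p (L y - b)) x = p (L x - b))"
    if "p \<in> polys m" for p
    using that
  proof (induction p rule: polys_induct)
    case zero
    show ?case using taylor_scale[of m 0 "\<lambda>_. 0"] by simp
  next
    case (add p q)
    have "L2_on K (\<lambda>y. p (L y - b))" "L2_on K (\<lambda>y. q (L y - b))"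
      using add by (auto intro!: L2_on_continuous compact_K continuous_intros continuous_L
          intro: continuous_on_compose2)
    then show ?case using add taylor_add by (auto intro: continuous_on_add)
  next
    case (scale k p)
    then show ?case by (auto simp: taylor_scale intro: continuous_on_mult_left)
  next
    case (monomial \<beta>)
    then have \<beta>: "\<beta> \<in> multi_indices (int l)" using m by (simp add: multi_indices_iff)
    have "taylor m (\<lambda>y. monomial \<beta> (L y - b)) x
       = (\<Sum>\<alpha>\<in>multi_indices m. if \<alpha> = \<beta> then monomial \<alpha> (L x - b) else 0)" for x
      unfolding taylor_def by (rule sum.cong) (auto simp: coeff_monomial[OF \<beta>] tensor_taylor_power)
    then have "taylor m (\<lambda>y. monomial \<beta> (L y - b)) x = monomial \<beta> (L x - b)" for x
      by (simp only: sum.delta[OF finite_multi_indices] monomial if_True)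
    then show ?case using polys_continuous[OF polys_monomial[OF monomial]] by blast
  qed
  ultimately have "taylor m (\<lambda>y. R (T (L y - b))) x = R (T (L x - b))" by blast
  then show ?thesis by (simp only: T)
qed

lemma continuous_taylor: "continuous_on S (taylor m f)"
proof -
  have "continuous_on UNIV (taylor_power a)" for a
    unfolding taylor_power_def[abs_def] by (intro continuous_intros) auto
  then show ?thesis unfolding taylor_def[abs_def]
    by (intro continuous_intros continuous_on_tensor_affine linear_L)
qed

lemma taylor_in_polys: "taylor m f \<in> polys m"
proof -
  have "(\<lambda>x. tensor taylor_power \<alpha> (L x - b)) \<in> polys m" if "\<alpha> \<in> multi_indices m" for \<alpha>
    using polys_scale[OF polys_compose[OF polys_monomial[OF that] polys_linear_component[OF linear_L]],
        of "inverse (\<Prod>i\<in>UNIV. fact (\<alpha> i))"]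
    by (simp add: tensor_taylor_power divide_inverse mult.commute)
  then show ?thesis unfolding taylor_def[abs_def] by (intro polys_sum polys_scale)
qed

text \<open>Reference coordinates are at most 1 in absolute value on \<open>K\<close>, hence so are
  the Taylor monomials, and the coefficients are bounded by the sup norms of the kernel derivatives.
  \<open>J\<close> stays explicit, to be balanced by the volume of \<open>K\<close>.\<close>

lemma abs_taylor_le:
  fixes B :: "('n \<Rightarrow> nat) \<Rightarrow> real"
  assumes f: "L2_on K f" and B: "\<And>\<alpha> z. \<alpha> \<in> multi_indices m \<Longrightarrow> \<bar>tensor \<eta> \<alpha> z\<bar> \<le> B \<alpha>" and x: "x \<in> K"
  shows "\<bar>taylor m f x\<bar> \<le> J * (\<Sum>\<alpha>\<in>multi_indices m. B \<alpha>) * (LINT y|lebesgue_on K. \<bar>f y\<bar>)"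
proof -
  interpret finite_measure "lebesgue_on K" by (rule finite_measure_lebesgue_on_compact[OF compact_K])
  have "f \<in> borel_measurable (lebesgue_on K)" "integrable (lebesgue_on K) (\<lambda>y. (f y)\<^sup>2)"
    using f sets_K by (simp_all add: L2_on_def set_integrable_lebesgue_on)
  then have fi: "integrable (lebesgue_on K) f" by (rule integrable_of_square_integrable)
  have c: "\<bar>coeff f \<alpha> * tensor taylor_power \<alpha> (L x - b)\<bar> \<le> J * B \<alpha> * (LINT y|lebesgue_on K. \<bar>f y\<bar>)"
    if \<alpha>: "\<alpha> \<in> multi_indices m" for \<alpha>
  proof -
    have "\<bar>LINT y|lebesgue_on K. f y * tensor \<eta> \<alpha> (L y - b)\<bar> \<le> (LINT y|lebesgue_on K. \<bar>f y * tensor \<eta> \<alpha> (L y - b)\<bar>)"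
      by (rule integral_abs_bound)
    also have "\<dots> \<le> (LINT y|lebesgue_on K. B \<alpha> * \<bar>f y\<bar>)"
    proof (rule integral_mono)
      show "integrable (lebesgue_on K) (\<lambda>y. \<bar>f y * tensor \<eta> \<alpha> (L y - b)\<bar>)"
        by (rule integrable_abs[OF integrable_tensor[OF f]])
      show "integrable (lebesgue_on K) (\<lambda>y. B \<alpha> * \<bar>f y\<bar>)" using fi by simp
      show "\<bar>f y * tensor \<eta> \<alpha> (L y - b)\<bar> \<le> B \<alpha> * \<bar>f y\<bar>" for y
        using mult_right_mono[OF B[OF \<alpha>, of "L y - b"], of "\<bar>f y\<bar>"] by (simp only: abs_mult mult.commute abs_ge_zero)
    qed
    also have "\<dots> = B \<alpha> * (LINT y|lebesgue_on K. \<bar>f y\<bar>)" by simp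
    finally have "\<bar>coeff f \<alpha>\<bar> \<le> J * (B \<alpha> * (LINT y|lebesgue_on K. \<bar>f y\<bar>))"
      using J_pos by (simp add: coeff_def abs_mult power_abs)
    moreover have "\<bar>tensor taylor_power \<alpha> (L x - b)\<bar> \<le> 1"
    proof -
      have "\<bar>taylor_power a t\<bar> \<le> 1" if "\<bar>t\<bar> \<le> 1" for a t
      proof -
        have "\<bar>t\<bar> ^ a \<le> 1" using that by (simp add: power_le_one)
        also have "(1::real) \<le> fact a" by (rule fact_ge_1)
        finally show ?thesis by (simp add: taylor_power_def abs_divide power_abs divide_le_eq_1)
      qed
      then show ?thesis
        unfolding tensor_def abs_prod using outer[OF x] by (intro prod_le_1) auto
    qed
    ultimately show ?thesis
      using order_trans[OF mult_left_le[of "\<bar>tensor taylor_power \<alpha> (L x - b)\<bar>" "\<bar>coeff f \<alpha>\<bar>"]]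
      by (simp add: abs_mult mult.assoc)
  qed
  have "\<bar>taylor m f x\<bar> \<le> (\<Sum>\<alpha>\<in>multi_indices m. \<bar>coeff f \<alpha> * tensor taylor_power \<alpha> (L x - b)\<bar>)"
    unfolding taylor_def by (rule sum_abs)
  also have "\<dots> \<le> (\<Sum>\<alpha>\<in>multi_indices m. J * B \<alpha> * (LINT y|lebesgue_on K. \<bar>f y\<bar>))"
    by (rule sum_mono) (rule c)
  finally show ?thesis by (simp add: sum_distrib_left sum_distrib_right mult.assoc)
qed

text \<open>The derivatives of \<open>v\<close> are moved onto the test function hidden in the coefficients.\<close>
lemma gradient_taylor:
  assumes v: "H1_with_grad K v g"
  obtains G where "\<And>x. (taylor m v has_derivative (\<lambda>h. G x \<bullet> h)) (at x)"
    "\<And>x i. G x $ i = taylor (m - 1) (\<lambda>y. g y $ i) x"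
proof -
  define G where "G x = adjoint L (\<chi> j. \<Sum>\<alpha>\<in>multi_indices (m - 1).
      coeff v (\<alpha>(j := Suc (\<alpha> j))) * tensor taylor_power \<alpha> (L x - b))" for x
  have coeff: "(\<Sum>j\<in>UNIV. L (axis i 1) $ j * coeff v (\<alpha>(j := Suc (\<alpha> j)))) = coeff (\<lambda>y. g y $ i) \<alpha>" for i \<alpha>
  proof -
    let ?D = "\<lambda>y. adjoint L (\<chi> j. tensor \<eta> (\<alpha>(j := Suc (\<alpha> j))) (L y - b))"
    have v2: "L2_on K v" and wg: "weak_gradient K v g" using v by (simp_all add: H1_with_grad_def)
    \<comment> \<open>The weak gradient is tested with the pulled-back kernel derivative of order
      \<open>\<alpha>\<close>, whose own gradient is \<open>?D\<close>.\<close>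
    have "(LINT y:K|lebesgue. v y * ?D y $ i) = - (LINT y:K|lebesgue. g y $ i * tensor \<eta> \<alpha> (L y - b))"
      using wg[unfolded weak_gradient_def, THEN conjunct2, rule_format, where D = ?D, OF test_fun_tensor[of \<alpha>]]
        has_derivative_tensor_tower[where F = \<eta> and \<alpha> = \<alpha> and b = b, OF \<eta>_deriv linear_L] by blast
    then have "(LINT y|lebesgue_on K. v y * ?D y $ i) = - (LINT y|lebesgue_on K. g y $ i * tensor \<eta> \<alpha> (L y - b))"
      by (simp add: LINT_lebesgue_on sets_K)
    moreover have "(LINT y|lebesgue_on K. v y * ?D y $ i) = (LINT y|lebesgue_on K.
        (\<Sum>j\<in>UNIV. L (axis i 1) $ j * (v y * tensor \<eta> (\<alpha>(j := Suc (\<alpha> j))) (L y - b))))"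
      by (simp add: adjoint_component[OF linear_L] sum_distrib_left mult.left_commute)
    moreover have "\<dots> = (\<Sum>j\<in>UNIV. L (axis i 1) $ j *
        (LINT y|lebesgue_on K. v y * tensor \<eta> (\<alpha>(j := Suc (\<alpha> j))) (L y - b)))"
      using integrable_tensor[OF v2] by (subst Bochner_Integration.integral_sum) auto
    ultimately have eq: "(\<Sum>j\<in>UNIV. L (axis i 1) $ j *
        (LINT y|lebesgue_on K. v y * tensor \<eta> (\<alpha>(j := Suc (\<alpha> j))) (L y - b)))
        = - (LINT y|lebesgue_on K. g y $ i * tensor \<eta> \<alpha> (L y - b))" by simp
    \<comment> \<open>Raising one index changes the parity of the total degree; this sign cancels
      the minus sign in the definition of the weak gradient.\<close>
    have "(\<Sum>k\<in>UNIV. (\<alpha>(j := Suc (\<alpha> j))) k) = Suc (\<Sum>k\<in>UNIV. \<alpha> k)" for j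
      using sum_fun_upd_nat[where \<alpha> = \<alpha> and j = j and a = "Suc (\<alpha> j)"] by (simp del: fun_upd_apply)
    then have "(\<Sum>j\<in>UNIV. L (axis i 1) $ j * coeff v (\<alpha>(j := Suc (\<alpha> j))))
      = - (J * (-1) ^ (\<Sum>k\<in>UNIV. \<alpha> k)) * (\<Sum>j\<in>UNIV. L (axis i 1) $ j *
        (LINT y|lebesgue_on K. v y * tensor \<eta> (\<alpha>(j := Suc (\<alpha> j))) (L y - b)))"
      by (simp add: coeff_def sum_distrib_left sum_negf mult_ac del: fun_upd_apply)
    then show ?thesis unfolding eq by (simp add: coeff_def)
  qed
  have "(taylor m v has_derivative (\<lambda>h. G x \<bullet> h)) (at x)" for x
    using has_derivative_taylor_sum[OF linear_L, where c = "coeff v" and b = b and m = m and y = x] by (simp add: taylor_def[abs_def] G_def)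
  moreover have "G x $ i = taylor (m - 1) (\<lambda>y. g y $ i) x" for x i
  proof -
    have "G x $ i = (\<Sum>j\<in>UNIV. \<Sum>\<alpha>\<in>multi_indices (m - 1).
       L (axis i 1) $ j * coeff v (\<alpha>(j := Suc (\<alpha> j))) * tensor taylor_power \<alpha> (L x - b))"
      by (simp add: G_def adjoint_component[OF linear_L] sum_distrib_left mult.assoc)
    also have "\<dots> = (\<Sum>\<alpha>\<in>multi_indices (m - 1). (\<Sum>j\<in>UNIV.
       L (axis i 1) $ j * coeff v (\<alpha>(j := Suc (\<alpha> j)))) * tensor taylor_power \<alpha> (L x - b))"
      by (subst sum.swap) (simp add: sum_distrib_right)
    finally show ?thesis by (simp only: coeff taylor_def)
  qed
  ultimately show thesis by (rule that)
qed

text \<open>\<open>K\<close> lies in the preimage of the cube [-1, 1]^n, whose volume is that of the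
  cube divided by \<open>J\<close>. The numerator is enlarged by 1 to be visibly positive.\<close>

lemma measure_K_le: "measure lebesgue K \<le> (measure lborel (cbox (- 1) (1 :: real^'n)) + 1) / J"
proof -
  let ?Q = "cbox (- 1) (1 :: real^'n)"
  have fin: "emeasure lborel ?Q = ennreal (measure lborel ?Q)"
    by (intro emeasure_eq_ennreal_measure) (simp add: emeasure_lborel_cbox_eq)
  have [measurable]: "(\<lambda>y. L y - b) \<in> borel_measurable borel"
    by (intro borel_measurable_continuous_onI continuous_intros continuous_L)
  have "K \<subseteq> (\<lambda>y. L y - b) -` ?Q"
  proof
    fix y assume "y \<in> K"
    then have "- 1 \<le> (L y - b) $ i \<and> (L y - b) $ i \<le> 1" for i using outer[of y i] by linarith
    then show "y \<in> (\<lambda>y. L y - b) -` ?Q" by (simp add: mem_box_cart)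
  qed
  then have "emeasure lborel K \<le> emeasure lborel ((\<lambda>y. L y - b) -` ?Q)"
    using measurable_sets[of "\<lambda>y. L y - b" borel borel ?Q] by (intro emeasure_mono) simp_all
  also have "\<dots> = ennreal (1 / J * measure lborel ?Q)"
    using J_pos by (subst J) (simp_all add: fin ennreal_mult'[symmetric])
  finally have "measure lborel K \<le> 1 / J * measure lborel ?Q"
    using J_pos by (simp add: measure_def enn2real_leI)
  also have "\<dots> \<le> (measure lborel ?Q + 1) / J" using J_pos by (simp add: divide_right_mono)
  finally show ?thesis
    using compact_K by (simp add: measure_completion borel_compact)
qed

end

section \<open>The estimate with a constant independent of the simplex\<close>

lemma tensor_bounded:
  assumes "smooth_tower \<rho> \<eta>"
  obtains B where "\<And>z. \<bar>tensor \<eta> \<alpha> z\<bar> \<le> B"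
proof -
  have "\<exists>B. \<forall>t. \<bar>\<eta> a t\<bar> \<le> B" for a
  proof -
    have "compact (\<eta> a ` {-\<bar>\<rho>\<bar>..\<bar>\<rho>\<bar>})"
      by (intro compact_continuous_image continuous_on_subset[OF smooth_tower_continuous[OF assms]]) auto
    then obtain B where B: "\<And>t. t \<in> {-\<bar>\<rho>\<bar>..\<bar>\<rho>\<bar>} \<Longrightarrow> \<bar>\<eta> a t\<bar> \<le> B"
      using compact_imp_bounded[of "\<eta> a ` {-\<bar>\<rho>\<bar>..\<bar>\<rho>\<bar>}"]
      unfolding bounded_iff by (metis (no_types, lifting) imageI real_norm_def)
    have "\<bar>\<eta> a t\<bar> \<le> \<bar>B\<bar>" for t
    proof (cases "t \<in> {-\<bar>\<rho>\<bar>..\<bar>\<rho>\<bar>}")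
      case True
      then show ?thesis using B[OF True] by linarith
    next
      case False
      then show ?thesis using assms by (auto simp: smooth_tower_def)
    qed
    then show ?thesis by blast
  qed
  then obtain B where B: "\<And>a t. \<bar>\<eta> a t\<bar> \<le> B a" by metis
  have "\<bar>tensor \<eta> \<alpha> z\<bar> \<le> (\<Prod>i\<in>UNIV. B (\<alpha> i))" for z
    unfolding tensor_def abs_prod by (intro prod_mono) (auto intro: B)
  then show thesis by (rule that)
qed

lemma L2_vnorm_on_le:
  fixes F :: "real^'n \<Rightarrow> real^'n"
  assumes K: "K \<in> sets lebesgue" and F: "\<And>i. integrable (lebesgue_on K) (\<lambda>x. (F x $ i)\<^sup>2)"
    and le: "\<And>i. L2_norm_on K (\<lambda>x. F x $ i) \<le> C * e i" and C: "C \<ge> 0"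
  shows "L2_vnorm_on K F \<le> C * sqrt (\<Sum>i\<in>UNIV. (e i)\<^sup>2)"
proof -
  have nn: "0 \<le> (LINT x|lebesgue_on K. (F x $ i)\<^sup>2)" for i by simp
  have "(LINT x|lebesgue_on K. (norm (F x))\<^sup>2) = (LINT x|lebesgue_on K. (\<Sum>i\<in>UNIV. (F x $ i)\<^sup>2))"
    by (simp add: norm_vec_def L2_set_def sum_nonneg)
  also have "\<dots> = (\<Sum>i\<in>UNIV. LINT x|lebesgue_on K. (F x $ i)\<^sup>2)"
    using F by (intro Bochner_Integration.integral_sum) auto
  also have "\<dots> = (\<Sum>i\<in>UNIV. (L2_norm_on K (\<lambda>x. F x $ i))\<^sup>2)"
    using nn by (simp add: L2_norm_on_def LINT_lebesgue_on[OF K])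
  also have "\<dots> \<le> (\<Sum>i\<in>UNIV. (C * e i)\<^sup>2)"
    using le nn by (intro sum_mono power_mono) (auto simp: L2_norm_on_def LINT_lebesgue_on[OF K])
  also have "\<dots> = C\<^sup>2 * (\<Sum>i\<in>UNIV. (e i)\<^sup>2)" by (simp add: power_mult_distrib sum_distrib_left)
  finally have "L2_vnorm_on K F \<le> sqrt (C\<^sup>2 * (\<Sum>i\<in>UNIV. (e i)\<^sup>2))"
    by (simp add: L2_vnorm_on_def LINT_lebesgue_on[OF K])
  then show ?thesis using C by (simp add: real_sqrt_mult)
qed

theorem theorem3p6:
  fixes l :: nat
  shows "\<exists>C::real. \<forall>(K :: (real^'n) set) v g.
           int CARD('n) simplex K \<longrightarrow> H1_with_grad K v g \<longrightarrow> err l K g \<le> C * err_low l K g"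
proof -
  define r where "r = 1 / (real CARD('n) * (real CARD('n) + 1))"
  define \<rho> where "\<rho> = r / 2"
  have r: "r > 0" by (simp add: r_def add_pos_pos)
  have \<rho>: "0 < \<rho>" "\<rho> < r" using r by (auto simp: \<rho>_def)
  obtain \<eta> where \<eta>: "smooth_tower \<rho> \<eta>"
    and \<eta>0: "\<And>k. k \<le> l \<Longrightarrow> (LINT t|lborel. \<eta> 0 t * t ^ k) = (if k = 0 then 1 else 0)"
    using smooth_tower_vanishing_moments[OF \<rho>(1), of l] by blast
  define m where "m = int l - 1"
  have "\<exists>B. \<forall>z. \<bar>tensor \<eta> \<alpha> z\<bar> \<le> B" for \<alpha> :: "'n \<Rightarrow> nat"
    using tensor_bounded[OF \<eta>, of \<alpha>] by blast
  then obtain B where B: "\<And>(\<alpha> :: 'n \<Rightarrow> nat) z. \<bar>tensor \<eta> \<alpha> z\<bar> \<le> B \<alpha>" by metis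
  define S where "S = (\<Sum>\<alpha>\<in>multi_indices m. B \<alpha>)"
  define V where "V = measure lborel (cbox (- 1) (1 :: real^'n)) + 1"
  have V: "V > 0" by (simp add: V_def add_nonneg_pos)
  \<comment> \<open>\<open>S\<close> bounds the operator in reference coordinates and
    \<open>V\<close> the reference volume. Both are fixed before \<open>K\<close> is given, so
    \<open>C\<close> depends only on the dimension and \<open>l\<close>.\<close>
  define C where "C = sqrt (2 + 2 * (S * V)\<^sup>2)"
  have C: "C > 0" unfolding C_def by (simp add: add_pos_nonneg)
  have "err l K g \<le> C * err_low l K g" if K: "int CARD('n) simplex K" and v: "H1_with_grad K v g" for K :: "(real^'n) set" and v g
  proof -
    obtain L :: "real^'n \<Rightarrow> real^'n" and b where L: "linear L" "surj L" "{y. \<forall>i. \<bar>(L y - b) $ i\<bar> < r} \<subseteq> K"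
      "\<And>y i. y \<in> K \<Longrightarrow> \<bar>(L y - b) $ i\<bar> \<le> 1"
      using simplex_affine_coordinates[OF K] unfolding r_def[symmetric] by blast
    obtain J where J: "J > 0"
      "\<And>A. A \<in> sets borel \<Longrightarrow> emeasure lborel ((\<lambda>y. L y - b) -` A) = ennreal (1 / J) * emeasure lborel A"
      using emeasure_affine_vimage[OF L(1,2)] by blast
    have mom: "(-1) ^ a * (LINT t|lborel. \<eta> a t * t ^ k) = (if a = k then fact a else 0)" if "k \<le> l" for a k
      using smooth_tower_moment[OF \<eta> \<rho>(1) \<eta>0 that] by simp
    interpret affine_coordinates K L b J r \<rho> \<eta> l
      by (rule affine_coordinates.intro[OF compact_simplex[OF K] L(1,2) J L(3,4) \<rho>(2) \<eta> mom])
    interpret M: finite_measure "lebesgue_on K" by (rule finite_measure_lebesgue_on_compact[OF compact_K])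
    obtain G where G: "\<And>x. (taylor (int l) v has_derivative (\<lambda>h. G x \<bullet> h)) (at x)"
      "\<And>x i. G x $ i = taylor m (\<lambda>y. g y $ i) x"
      using gradient_taylor[OF v, of "int l"] unfolding m_def by blast
    have g2: "L2_on K (\<lambda>y. g y $ i)" for i
      using v by (simp add: H1_with_grad_def weak_gradient_def)
    \<comment> \<open>\<open>G\<close> is fixed before \<open>R\<close>. Since the projection
      reproduces \<open>R\<close>, the error \<open>g x $ i - G x $ i\<close> equals
      \<open>?f x - ?p x\<close> for \<open>?f = g_i - R\<close>, and boundedness of the projection
      bounds it by the norm of \<open>?f\<close>.\<close>
    have comp: "integrable (lebesgue_on K) (\<lambda>x. (g x $ i - G x $ i)\<^sup>2) \<and>
        L2_norm_on K (\<lambda>x. g x $ i - G x $ i) \<le> C * L2_norm_on K (\<lambda>x. g x $ i - R x)"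
      if R: "R \<in> polys m" for R i
    proof -
      let ?f = "\<lambda>x. g x $ i - R x"
      let ?p = "taylor m ?f"
      have cR: "continuous_on K R" by (rule polys_continuous[OF R])
      have f2: "L2_on K ?f" by (rule L2_on_diff_continuous[OF compact_K g2 cR])
      then have f: "?f \<in> borel_measurable (lebesgue_on K)" "integrable (lebesgue_on K) (\<lambda>x. (?f x)\<^sup>2)"
        using sets_K by (simp_all add: L2_on_def set_integrable_lebesgue_on)
      have "taylor m (\<lambda>y. ?f y + R y) x = ?p x + R x" for x
        using taylor_add[OF f2 L2_on_continuous[OF compact_K cR]] taylor_reproduces[OF R]
        by (simp add: m_def)
      then have diff: "g x $ i - G x $ i = ?f x - ?p x" for x by (simp add: G(2))
      have p: "?p \<in> borel_measurable (lebesgue_on K)"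
        by (rule measurable_lebesgue_on_continuous[OF compact_K continuous_taylor])
      have bound: "\<bar>?p x\<bar> \<le> (J * S) * (LINT x|lebesgue_on K. \<bar>?f x\<bar>)" if "x \<in> space (lebesgue_on K)" for x
        unfolding S_def using that B by (intro abs_taylor_le f2) (auto simp: space_restrict_space)
      have "measure (lebesgue_on K) (space (lebesgue_on K)) \<le> V / J"
        using measure_K_le sets_K by (simp add: V_def space_restrict_space measure_restrict_space)
      note est = M.square_integral_diff_bound[OF f p bound this divide_pos_pos[OF V J_pos]]
      \<comment> \<open>Here the shape of the simplex leaves the estimate.\<close>
      have "(J * S) * (V / J) = S * V" using J_pos by simp
      with est(2) have "(LINT x|lebesgue_on K. (?f x - ?p x)\<^sup>2) \<le> (2 + 2 * (S * V)\<^sup>2) * (LINT x|lebesgue_on K. (?f x)\<^sup>2)"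
        by (simp only:)
      then have "sqrt (LINT x|lebesgue_on K. (?f x - ?p x)\<^sup>2) \<le> C * sqrt (LINT x|lebesgue_on K. (?f x)\<^sup>2)"
        unfolding C_def real_sqrt_mult[symmetric] by (rule real_sqrt_le_mono)
      then show ?thesis using est(1) by (simp only: diff L2_norm_on_def LINT_lebesgue_on[OF sets_K] simp_thms)
    qed
    define e where "e i = Inf {L2_norm_on K (\<lambda>x. g x $ i - R x) | R. R \<in> polys m}" for i
    have "L2_norm_on K (\<lambda>x. (g x - G x) $ i) \<le> C * e i" for i
    proof -
      \<comment> \<open>Dividing by \<open>C > 0\<close> turns the bound for every \<open>R\<close>
        into a lower bound for the infimum, which need not be known to be attained.\<close>
      have "L2_norm_on K (\<lambda>x. g x $ i - G x $ i) / C \<le> e i"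
        unfolding e_def
      proof (rule cInf_greatest)
        show "{L2_norm_on K (\<lambda>x. g x $ i - R x) | R. R \<in> polys m} \<noteq> {}" using polys_zero by blast
      next
        fix t assume "t \<in> {L2_norm_on K (\<lambda>x. g x $ i - R x) | R. R \<in> polys m}"
        then show "L2_norm_on K (\<lambda>x. g x $ i - G x $ i) / C \<le> t"
          using comp C by (auto simp: divide_le_eq mult.commute)
      qed
      then show ?thesis using C by (simp add: divide_le_eq mult.commute)
    qed
    \<comment> \<open>Square-integrability of the components of \<open>g - G\<close> is read off
      from \<open>comp\<close> with \<open>R = 0\<close>, which lies in \<open>polys m\<close> even
      for \<open>m = -1\<close>.\<close>
    then have "L2_vnorm_on K (\<lambda>x. g x - G x) \<le> C * sqrt (\<Sum>i\<in>UNIV. (e i)\<^sup>2)"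
      using comp[OF polys_zero] C by (intro L2_vnorm_on_le sets_K) auto
    then have le: "L2_vnorm_on K (\<lambda>x. g x - G x) \<le> C * err_low l K g"
      by (simp add: err_low_def e_def m_def)
    have "err l K g \<le> L2_vnorm_on K (\<lambda>x. g x - G x)"
      unfolding err_def
    proof (rule cInf_lower)
      show "L2_vnorm_on K (\<lambda>x. g x - G x) \<in> {L2_vnorm_on K (\<lambda>x. g x - G x) | P G.
          P \<in> polys (int l) \<and> (\<forall>x. (P has_derivative (\<lambda>h. G x \<bullet> h)) (at x))}"
        using G(1) taylor_in_polys by blast
      show "bdd_below {L2_vnorm_on K (\<lambda>x. g x - G x) | P G.
          P \<in> polys (int l) \<and> (\<forall>x. (P has_derivative (\<lambda>h. G x \<bullet> h)) (at x))}"
        by (intro bdd_belowI[of _ 0]) (auto simp: L2_vnorm_on_def LINT_lebesgue_on[OF sets_K])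
    qed
    then show ?thesis using le by linarith
  qed
  then show ?thesis by blast
qed

end
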